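(* Let $S$ be a signature and $\mathbb K$ a field. For any leaning $S$-forests $F_1$ and $F_2$, in the algebra $A$ (the natural Hopf algebra of the free nonsymmetric operad on $S$), $\mathbf H_{F_1}\cdot\mathbf H_{F_2}=\mathbf H_{F_1\lhd F_2}$.
   Context: A signature is a set $S$ with arity map $|\cdot|:S\to\mathbb N$. An $S$-term is either the leaf $\ell$ or $s\,t_1\cdots t_{|s|}$ ($s\in S$, $t_i$ $S$-terms). Internal nodes are numbered $1,\dots,\deg t$ in preorder (root first, then subterms left to right); $\mathrm{dc}(t)$ is the word of decorations; children (leaves included) are numbered from $1$ left to right; node $i$ has parent edge $(\mathrm{pa}(i),\mathrm{lp}(i),i)$ (convention $\mathrm{pa}(1)=1,\mathrm{lp}(1)=0$); $\mathrm{cnc}(t)(i)=\mathrm{pa}(i)+1-2^{\mathrm{lp}(i)-a}$ with $a$ the arity of the decoration of $\mathrm{pa}(i)$; $t_1\preceq t_2$ iff $\mathrm{dc}(t_1)=\mathrm{dc}(t_2)$ and $\mathrm{cnc}(t_1)\le\mathrm{cnc}(t_2)$ componentwise. A leaf is extreme if all internal nodes are visited before it in preorder. $\mathrm{tlt}(\{1\})(t)$ reorders the children of the root so that non-leaf children keep their order and precede leaf children. Let $S_{\mathbb N}=S\sqcup\mathbb N$ with $n\in\mathbb N$ of arity $n$. An $S$-forest is an $S_{\mathbb N}$-term $n\,t_1\cdots t_n$ with $t_i$ $S$-terms; it is balanced if its degree is $n+1$, then its size is $n$; it is leaning if balanced and fixed by $\mathrm{tlt}(\{1\})$; forests are ordered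 by $\preceq$. Concatenation: $(n\,t_1\cdots t_n)\cdot(n'\,t'_1\cdots t'_{n'})=(n+n')\,t_1\cdots t_nt'_1\cdots t'_{n'}$. Over: $F_1\rhd F_2:=\mathrm{tlt}(\{1\})(F_1\cdot F_2)$. Under: if $F_1,F_2$ have sizes $n_1,n_2$ and $F_1$ has $r$ extreme leaves, $F_1\lhd F_2$ is obtained by grafting, for each $j\in[n_2+r]$, the $j$-th child subterm of the root of $F_2\cdot c(r)$ onto the $j$-th extreme leaf of $F_1\cdot c(n_2)$, where $c(k)=k\,\ell\cdots\ell$ ($k$ leaves). Let $A$ be the $\mathbb K$-vector space with basis $\{\mathbf E_F\}$ indexed by leaning $S$-forests, with associative product $\mathbf E_{F_1}\cdot\mathbf E_{F_2}=\mathbf E_{F_1\rhd F_2}$. The fundamental basis is $\mathbf F_F:=\sum_{F\preceq F'}\mu(F,F')\,\mathbf E_{F'}$ (sum over leaning $F'$), with $\mu$ the Möbius function of the poset of leaning $S$-forests ordered by $\preceq$; the homogeneous basis is $\mathbf H_F:=\sum_{F'\preceq F}\mathbf F_{F'}$ (sum over leaning $F'$). *)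

theory Defs
  imports Complex_Main "HOL-Library.Poly_Mapping"
begin

datatype 'd tm = Leaf | Node 'd (children: "'d tm list")

fun is_term :: "'d set \<Rightarrow> ('d \<Rightarrow> nat) \<Rightarrow> 'd tm \<Rightarrow> bool" where
  "is_term S ar Leaf \<longleftrightarrow> True"
| "is_term S ar (Node s ts) \<longleftrightarrow> s \<in> S \<and> length ts = ar s \<and> (\<forall>t\<in>set ts. is_term S ar t)"

text \<open>
  The nodes (leaves included) of a term in preorder. A node is given by its address, that is, by
  the numbers of the children (counted from 1) followed on the way from the root to it, and it
  comes with its decoration, \<^term>\<open>None\<close> for a leaf.
\<close>

primrec traversal :: "'d tm \<Rightarrow> (nat list \<times> 'd option) list" where
  "traversal Leaf = [([], None)]"
| "traversal (Node s ts) = ([], Some s) #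
     concat (map (\<lambda>(j, ns). map (\<lambda>(p, d). (j # p, d)) ns) (enumerate 1 (map traversal ts)))"

definition internals :: "'d tm \<Rightarrow> (nat list \<times> 'd) list" where
  "internals t = [(p, s). (p, Some s) \<leftarrow> traversal t]"

definition dc :: "'d tm \<Rightarrow> 'd list" where
  "dc t = map snd (internals t)"

definition deg :: "'d tm \<Rightarrow> nat" where
  "deg t = length (dc t)"

text \<open>Internal nodes are numbered from 1, whereas list indices start at 0.\<close>

definition address :: "'d tm \<Rightarrow> nat \<Rightarrow> nat list" where
  "address t i = fst (internals t ! (i - 1))"

definition decoration :: "'d tm \<Rightarrow> nat \<Rightarrow> 'd" where
  "decoration t i = dc t ! (i - 1)"

definition pa :: "'d tm \<Rightarrow> nat \<Rightarrow> nat" where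
  "pa t i = (if i = 1 then 1 else (THE k. k \<in> {1..deg t} \<and> address t k = butlast (address t i)))"

definition lp :: "'d tm \<Rightarrow> nat \<Rightarrow> nat" where
  "lp t i = (if i = 1 then 0 else last (address t i))"

definition cnc :: "('d \<Rightarrow> nat) \<Rightarrow> 'd tm \<Rightarrow> nat \<Rightarrow> real" where
  "cnc ar t i =
     real (pa t i) + 1 - 2 powi (int (lp t i) - int (ar (decoration t (pa t i))))"

definition tm_le :: "('d \<Rightarrow> nat) \<Rightarrow> 'd tm \<Rightarrow> 'd tm \<Rightarrow> bool" where
  "tm_le ar t t' \<longleftrightarrow> dc t = dc t' \<and> (\<forall>i\<in>{1..deg t}. cnc ar t i \<le> cnc ar t' i)"

definition extreme_leaves :: "'d tm \<Rightarrow> nat list list" where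
  "extreme_leaves t = (let ns = traversal t in
     [fst (ns ! k). k \<leftarrow> [0..<length ns],
        snd (ns ! k) = None \<and> (\<forall>j<length ns. snd (ns ! j) \<noteq> None \<longrightarrow> j < k)])"

text \<open>Simultaneous grafting: the leaf at address \<open>p\<close> is replaced by \<open>g p\<close>.\<close>

primrec graft :: "'d tm \<Rightarrow> (nat list \<Rightarrow> 'd tm) \<Rightarrow> 'd tm" where
  "graft Leaf = (\<lambda>g. g [])"
| "graft (Node s ts) =
     (\<lambda>g. Node s (map (\<lambda>(j, h). h (\<lambda>p. g (j # p))) (enumerate 1 (map graft ts))))"

definition graft_list :: "'d tm \<Rightarrow> nat list list \<Rightarrow> 'd tm list \<Rightarrow> 'd tm" where
  "graft_list t ps us =
     graft t (\<lambda>p. case map_of (zip ps us) p of Some u \<Rightarrow> u | None \<Rightarrow> Leaf)"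

text \<open>\<open>tlt1\<close> is the operation \<open>tlt({1})\<close>.\<close>

primrec tlt1 :: "'d tm \<Rightarrow> 'd tm" where
  "tlt1 Leaf = Leaf"
| "tlt1 (Node s ts) = Node s (filter (\<lambda>t. t \<noteq> Leaf) ts @ filter (\<lambda>t. t = Leaf) ts)"

text \<open>
  The decorations \<open>S \<squnion> \<nat>\<close> are modelled by the type \<^typ>\<open>'s + nat\<close>; an \<open>S\<close>-term, seen as a
  subterm of a forest, has all its decorations in \<^term>\<open>Inl ` S\<close>.
\<close>

type_synonym 's forest = "('s + nat) tm"

definition ext_arity :: "('s \<Rightarrow> nat) \<Rightarrow> 's + nat \<Rightarrow> nat" where
  "ext_arity ar = case_sum ar (\<lambda>n. n)"

definition is_forest :: "'s set \<Rightarrow> ('s \<Rightarrow> nat) \<Rightarrow> 's forest \<Rightarrow> bool" where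
  "is_forest S ar F \<longleftrightarrow>
     (\<exists>n ts. F = Node (Inr n) ts \<and> length ts = n \<and> (\<forall>t\<in>set ts. is_term (Inl ` S) (ext_arity ar) t))"

fun root_arity :: "'s forest \<Rightarrow> nat" where
  "root_arity (Node (Inr n) ts) = n"

definition balanced :: "'s set \<Rightarrow> ('s \<Rightarrow> nat) \<Rightarrow> 's forest \<Rightarrow> bool" where
  "balanced S ar F \<longleftrightarrow> is_forest S ar F \<and> deg F = root_arity F + 1"

definition leaning :: "'s set \<Rightarrow> ('s \<Rightarrow> nat) \<Rightarrow> 's forest \<Rightarrow> bool" where
  "leaning S ar F \<longleftrightarrow> balanced S ar F \<and> tlt1 F = F"

definition leaning_order :: "'s set \<Rightarrow> ('s \<Rightarrow> nat) \<Rightarrow> 's forest rel" where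
  "leaning_order S ar =
     {(F, G). leaning S ar F \<and> leaning S ar G \<and> tm_le (ext_arity ar) F G}"

fun conc :: "'s forest \<Rightarrow> 's forest \<Rightarrow> 's forest" where
  "conc (Node (Inr n) ts) (Node (Inr n') ts') = Node (Inr (n + n')) (ts @ ts')"

definition corolla :: "nat \<Rightarrow> 's forest" where
  "corolla k = Node (Inr k) (replicate k Leaf)"

definition over_forest :: "'s forest \<Rightarrow> 's forest \<Rightarrow> 's forest" where
  "over_forest F G = tlt1 (conc F G)"

definition under_forest :: "'s forest \<Rightarrow> 's forest \<Rightarrow> 's forest" where
  "under_forest F G =
     (let n = root_arity G;
          r = length (extreme_leaves F);
          F' = conc F (corolla n)
      in graft_list F' (extreme_leaves F') (children (conc G (corolla r))))"

text \<open>
  The Moebius function of a poset given as a relation; local finiteness makes the recursion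
  terminate. \<^term>\<open>leaning_order S ar\<close> is a locally finite order: comparable forests share
  their word of decorations, finitely many forests have a given such word, and among these a
  forest is determined by its values of \<^const>\<open>cnc\<close>, which encode the parent edges.
\<close>

definition interval :: "'a rel \<Rightarrow> 'a \<Rightarrow> 'a \<Rightarrow> 'a set" where
  "interval r x y = {z. (x, z) \<in> r \<and> (z, y) \<in> r}"

definition locally_finite_order :: "'a rel \<Rightarrow> bool" where
  "locally_finite_order r \<longleftrightarrow>
     partial_order_on (Field r) r \<and> (\<forall>x y. finite (interval r x y))"

function moebius :: "'a rel \<Rightarrow> 'a \<Rightarrow> 'a \<Rightarrow> int" where
  "moebius r x y =
     (if locally_finite_order r \<and> (x, y) \<in> r
      then if x = y then 1 else - (\<Sum>z\<in>interval r x y - {y}. moebius r x z)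
      else 0)"
  by auto
termination
proof (relation "measure (\<lambda>(r, x, y). card (interval r x y))", goal_cases)
  case (2 r x y z)
  then have "trans r" "antisym r" "finite (interval r x y)"
    by (auto simp: locally_finite_order_def partial_order_on_def preorder_on_def)
  moreover have "y \<in> interval r x y"
    using 2 by (auto simp: interval_def locally_finite_order_def partial_order_on_def
        preorder_on_def refl_on_def Field_def)
  ultimately have "interval r x z \<subset> interval r x y"
    using 2 unfolding interval_def by (auto dest: transD antisymD)
  then show ?case
    using \<open>finite (interval r x y)\<close> by (simp add: psubset_card_mono)
qed simp

declare moebius.simps [simp del]

text \<open>
  Vectors of the algebra are finitely supported functions from forests to scalars; the algebra
  itself consists of the vectors supported on leaning forests. The multiple \<open>c \<cdot> E\<^sub>F\<close> of a basis
  vector is \<open>Poly_Mapping.single F c\<close>; \<open>mult\<close> extends \<open>E\<^sub>F \<cdot> E\<^sub>G = E\<^bsub>over_forest F G\<^esub>\<close> bilinearly.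
\<close>

type_synonym ('s, 'k) vec = "'s forest \<Rightarrow>\<^sub>0 'k"

definition mult :: "('s, 'k::field) vec \<Rightarrow> ('s, 'k) vec \<Rightarrow> ('s, 'k) vec" where
  "mult x y = (\<Sum>F\<in>Poly_Mapping.keys x. \<Sum>G\<in>Poly_Mapping.keys y.
     Poly_Mapping.single (over_forest F G) (Poly_Mapping.lookup x F * Poly_Mapping.lookup y G))"

definition F_basis :: "'s set \<Rightarrow> ('s \<Rightarrow> nat) \<Rightarrow> 's forest \<Rightarrow> ('s, 'k::field) vec" where
  "F_basis S ar F = (\<Sum>F' | (F, F') \<in> leaning_order S ar.
     Poly_Mapping.single F' (of_int (moebius (leaning_order S ar) F F')))"

definition H_basis :: "'s set \<Rightarrow> ('s \<Rightarrow> nat) \<Rightarrow> 's forest \<Rightarrow> ('s, 'k::field) vec" where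
  "H_basis S ar F = (\<Sum>F' | (F', F) \<in> leaning_order S ar. F_basis S ar F')"

end

(*
  A leaning forest is determined by its word of decorations together with the parent edges of its
  nonroot nodes, children of the root counting as a bottom value.  In these terms, for words u and
  v, cutting a forest with word uv into its first |u| nodes and the remaining ones (whose edges to
  the first part are replaced by edges to the root) is a monotone map pi from the forests with word
  uv to pairs of forests with words u and v; the over product is its left adjoint, and the under
  product, which greedily attaches the roots of the second forest at the largest available
  positions, is its right adjoint.  Expanding E into F by Moebius inversion, the left adjunction
  says that the product of F_X and F_Y is the sum of all F_q with pi(q) = (X, Y), so that the
  product of H_X and H_Y is the sum of all F_q with pi(q) <= (X, Y), which by the right adjunction
  is the sum over q below the under product.
*)

theory Submission
  imports Defs "HOL-Library.List_Lexorder"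
begin

section \<open>Addresses of the nodes of a term\<close>

text \<open>Extreme leaves and preorder are defined by traversing a term, whereas the order compares
  numbers. Both are turned into comparisons of addresses: preorder is the lexicographic order, and a
  child position of node \<open>p\<close> is visited after all nodes present exactly when its edge
  is below the edges of all nodes after \<open>p\<close>. Apart from bounds on parents and
  positions, this is the only condition on a sequence of edges to come from a term, and such a term
  can be built node by node at extreme leaves.

  Among extreme leaves, earlier in preorder means larger edge. This is why grafting in preorder is
  greedy for the order, and hence a right adjoint.

  Positions of root children are forgotten because cutting renumbers them. Leaning recovers them by
  counting, and balance leaves the root room for every node, so every valid code is realised and the
  cut exists.

  Products of fundamental vectors are never formed: the coordinate of a vector at F_q is the sum of
  its E-coefficients over all X below q, and the identity is verified through these
  coordinates.\<close>

primrec traversals :: "nat \<Rightarrow> 'd tm list \<Rightarrow> (nat list \<times> 'd option) list" where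
  "traversals b [] = []"
| "traversals b (t # ts) = map (apfst (Cons b)) (traversal t) @ traversals (Suc b) ts"

text \<open>The free start index \<open>b\<close> makes inductions over the list of children
  possible; a node uses the instance 1.\<close>

primrec internalss :: "nat \<Rightarrow> 'd tm list \<Rightarrow> (nat list \<times> 'd) list" where
  "internalss b [] = []"
| "internalss b (t # ts) = map (apfst (Cons b)) (internals t) @ internalss (Suc b) ts"

lemma traversals_eq:
  "traversals b ts =
     concat (map (\<lambda>(j, ns). map (\<lambda>(p, d). (j # p, d)) ns) (enumerate b (map traversal ts)))"
  by (induction ts arbitrary: b) (auto simp: apfst_def map_prod_def)

lemma traversal_Node: "traversal (Node s ts) = ([], Some s) # traversals 1 ts"
  by (simp add: traversals_eq)

declare traversal.simps(2) [simp del]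

definition somes :: "('a \<times> 'd option) list \<Rightarrow> ('a \<times> 'd) list" where
  "somes xs = [(p, s). (p, Some s) \<leftarrow> xs]"

lemma somes_simps [simp]:
  "somes [] = []" "somes ((p, None) # xs) = somes xs"
  "somes ((p, Some s) # xs) = (p, s) # somes xs"
  by (simp_all add: somes_def)

lemma somes_append [simp]: "somes (xs @ ys) = somes xs @ somes ys"
  by (simp add: somes_def)

lemma somes_map_apfst [simp]: "somes (map (apfst f) xs) = map (apfst f) (somes xs)"
proof (induction xs)
  case (Cons x xs)
  then show ?case by (cases x; cases "snd x") auto
qed simp

lemma set_somes: "(p, s) \<in> set (somes xs) \<longleftrightarrow> (p, Some s) \<in> set xs"
proof (induction xs)
  case (Cons x xs)
  then show ?case by (cases x; cases "snd x") auto
qed simp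

lemma somes_eq_Nil: "(\<forall>x\<in>set xs. snd x = None) \<Longrightarrow> somes xs = []"
proof (induction xs)
  case (Cons x xs)
  then show ?case by (cases x) auto
qed simp

lemma internals_somes: "internals t = somes (traversal t)"
  by (simp add: internals_def somes_def)

lemma somes_traversals [simp]: "somes (traversals b ts) = internalss b ts"
  by (induction ts arbitrary: b) (auto simp: internals_somes)

lemma internals_Leaf [simp]: "internals Leaf = []"
  by (simp add: internals_somes)

lemma internals_Node: "internals (Node s ts) = ([], s) # internalss 1 ts"
  by (simp add: internals_somes traversal_Node)

lemma in_internals_iff: "(p, s) \<in> set (internals t) \<longleftrightarrow> (p, Some s) \<in> set (traversal t)"
  by (simp add: internals_somes set_somes)

lemma in_apfst_image [simp]: "(p, d) \<in> apfst f ` X \<longleftrightarrow> (\<exists>q. p = f q \<and> (q, d) \<in> X)"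
  by (force simp: image_iff)

lemma in_traversals:
  "(p, d) \<in> set (traversals b ts) \<longleftrightarrow>
     (\<exists>i q. p = (b + i) # q \<and> i < length ts \<and> (q, d) \<in> set (traversal (ts ! i)))"
proof (induction ts arbitrary: b)
  case (Cons t ts)
  show ?case
    unfolding traversals.simps set_append set_map Un_iff in_apfst_image Cons.IH
    by (auto simp: all_simps less_Suc_eq_0_disj intro: exI[of _ 0] exI[of _ "Suc _"])
qed simp

lemma in_traversal_Node [simp]:
  "([], d) \<in> set (traversal (Node s ts)) \<longleftrightarrow> d = Some s"
  "(j # p, d) \<in> set (traversal (Node s ts)) \<longleftrightarrow>
     (\<exists>i. j = Suc i \<and> i < length ts \<and> (p, d) \<in> set (traversal (ts ! i)))"
  by (auto simp: traversal_Node in_traversals)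

lemma traversals_append [simp]:
  "traversals b (ts @ us) = traversals b ts @ traversals (b + length ts) us"
  by (induction ts arbitrary: b) auto

lemma internalss_append [simp]:
  "internalss b (ts @ us) = internalss b ts @ internalss (b + length ts) us"
  by (induction ts arbitrary: b) auto

lemma internalss_replicate_Leaf [simp]: "internalss b (replicate n Leaf) = []"
  by (induction n arbitrary: b) auto

text \<open>The second conjunct carries the induction: the later subterms have larger child numbers,
  so their addresses exceed all those of the first one.\<close>

lemma sorted_traversals:
  assumes "\<And>t. t \<in> set ts \<Longrightarrow> sorted_wrt (<) (map fst (traversal t))"
  shows "sorted_wrt (<) (map fst (traversals b ts)) \<and>
    (\<forall>p\<in>set (map fst (traversals b ts)). \<exists>j q. p = j # q \<and> b \<le> j)"
  using assms
proof (induction ts arbitrary: b)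
  case (Cons t ts)
  from Cons.IH[of "Suc b"] Cons.prems
  have IH: "sorted_wrt (<) (map fst (traversals (Suc b) ts))"
    "\<forall>p\<in>set (map fst (traversals (Suc b) ts)). \<exists>j q. p = j # q \<and> Suc b \<le> j" by auto
  moreover have "sorted_wrt (<) (map fst (map (apfst (Cons b)) (traversal t)))"
    using Cons.prems[of t] by (simp add: sorted_wrt_map)
  ultimately show ?case
    by (fastforce simp: sorted_wrt_append)
qed simp

text \<open>Preorder is the lexicographic order of addresses: an ancestor is a prefix, hence
  smaller, and siblings compare by position.\<close>

lemma sorted_traversal: "sorted_wrt (<) (map fst (traversal t))"
proof (induction t)
  case (Node s ts)
  then show ?case using sorted_traversals[of ts 1] by (fastforce simp: traversal_Node)
qed simp

lemma sorted_somes: "sorted_wrt (<) (map fst xs) \<Longrightarrow> sorted_wrt (<) (map fst (somes xs))"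
proof (induction xs)
  case (Cons x xs)
  then show ?case by (cases x; cases "snd x") (auto simp: set_somes dest: bspec)
qed simp

definition addrs :: "'d tm \<Rightarrow> nat list list" where
  "addrs t = map fst (internals t)"

lemma sorted_addrs: "sorted_wrt (<) (addrs t)"
  unfolding addrs_def internals_somes by (intro sorted_somes sorted_traversal)

lemma distinct_addrs: "distinct (addrs t)"
  using sorted_addrs strict_sorted_iff by blast

lemma distinct_traversal: "distinct (map fst (traversal t))"
  using sorted_traversal strict_sorted_iff by blast

lemma length_addrs [simp]: "length (addrs t) = deg t"
  by (simp add: addrs_def deg_def dc_def)

lemma length_dc [simp]: "length (dc t) = deg t"
  by (simp add: deg_def)

lemma length_internals [simp]: "length (internals t) = deg t"
  by (simp add: deg_def dc_def)

lemma internals_eq_zip: "internals t = zip (addrs t) (dc t)"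
  by (simp add: addrs_def dc_def zip_map_fst_snd)

lemma addrs_less_iff: "i < deg t \<Longrightarrow> j < deg t \<Longrightarrow> addrs t ! i < addrs t ! j \<longleftrightarrow> i < j"
  using sorted_wrt_nth_less[OF sorted_addrs[of t]] 
  by (metis length_addrs not_less_iff_gr_or_eq order_less_imp_not_less)

lemma addrs_eq_iff: "i < deg t \<Longrightarrow> j < deg t \<Longrightarrow> addrs t ! i = addrs t ! j \<longleftrightarrow> i = j"
  using distinct_addrs[of t] by (simp add: nth_eq_iff_index_eq)

lemma addrs_0 [simp]: "0 < deg t \<Longrightarrow> addrs t ! 0 = []"
  by (cases t) (simp_all add: addrs_def internals_Node deg_def dc_def)

lemma addrs_Nil_iff: "i < deg t \<Longrightarrow> addrs t ! i = [] \<longleftrightarrow> i = 0"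
  using addrs_eq_iff[of i t 0] by (cases "deg t") auto

lemma in_addrs_iff: "p \<in> set (addrs t) \<longleftrightarrow> (\<exists>s. (p, Some s) \<in> set (traversal t))"
  unfolding addrs_def by (force simp: in_internals_iff[symmetric])

lemma dc_addrs:
  "i < deg t \<Longrightarrow> (addrs t ! i, Some (dc t ! i)) \<in> set (traversal t)"
  unfolding in_internals_iff[symmetric] internals_eq_zip
  by (simp add: in_set_zip) (use length_addrs length_dc in blast)

section \<open>Parents and children, and recovering a term from its internal nodes\<close>

lemma traversal_parent:
  "(p @ [l], d) \<in> set (traversal t) \<Longrightarrow> is_term A ar t \<Longrightarrow>
     \<exists>s. (p, Some s) \<in> set (traversal t) \<and> 1 \<le> l \<and> l \<le> ar s"
proof (induction p arbitrary: t)
  case Nil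
  then show ?case by (cases t) auto
next
  case (Cons j p)
  then show ?case by (cases t) fastforce+
qed

lemma traversal_child:
  "(p, Some s) \<in> set (traversal t) \<Longrightarrow> is_term A ar t \<Longrightarrow> 1 \<le> l \<Longrightarrow> l \<le> ar s \<Longrightarrow>
     \<exists>d. (p @ [l], d) \<in> set (traversal t)"
proof (induction p arbitrary: t)
  case Nil
  then obtain ts where t: "t = Node s ts" "length ts = ar s" by (cases t) auto
  then have "\<exists>d. ([], d) \<in> set (traversal (ts ! (l - 1)))"
    by (cases "ts ! (l - 1)") (auto simp: traversal_Node)
  with t Nil show ?case by (auto intro!: exI[of _ "l - 1"])
next
  case (Cons j p)
  then obtain s' ts where t: "t = Node s' ts" by (cases t) auto
  with Cons.prems obtain i where i: "j = Suc i" "i < length ts" "(p, Some s) \<in> set (traversal (ts ! i))"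
    by auto
  with Cons.IH[of "ts ! i"] Cons.prems t show ?case by auto
qed

text \<open>The arity of a node fixes its number of children, and a child that is not an internal
  node must be a leaf; so the leaves carry no further information.\<close>

lemma internals_inj:
  "is_term A ar t \<Longrightarrow> is_term B ar t' \<Longrightarrow>
     (\<And>p s. (p, Some s) \<in> set (traversal t) \<longleftrightarrow> (p, Some s) \<in> set (traversal t')) \<Longrightarrow> t = t'"
proof (induction t arbitrary: t')
  case Leaf
  from Leaf(3)[of "[]"] show ?case by (cases t') auto
next
  case (Node s ts)
  from Node(4)[of "[]" s] obtain ts' where t': "t' = Node s ts'" by (cases t') auto
  have len: "length ts = length ts'" using Node.prems t' by simp
  have "ts ! i = ts' ! i" if i: "i < length ts" for i
  proof (rule Node.IH)
    show "ts ! i \<in> set ts" "is_term A ar (ts ! i)" "is_term B ar (ts' ! i)"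
      using i len Node.prems t' by auto
    show "(p, Some s) \<in> set (traversal (ts ! i)) \<longleftrightarrow> (p, Some s) \<in> set (traversal (ts' ! i))" for p s
      using Node(4)[of "Suc i # p" s] t' i len by simp
  qed
  with len t' show ?case by (simp add: nth_equalityI)
qed

lemma term_eqI:
  assumes "is_term A ar t" "is_term B ar t'" "addrs t = addrs t'" "dc t = dc t'"
  shows "t = t'"
  using assms(1,2)
proof (rule internals_inj)
  have "internals t = internals t'" using assms by (simp add: internals_eq_zip)
  then show "(p, Some s) \<in> set (traversal t) \<longleftrightarrow> (p, Some s) \<in> set (traversal t')" for p s
    by (simp add: in_internals_iff[symmetric])
qed

lemma map_snd_internalss: "map snd (internalss b ts) = concat (map dc ts)"
  by (induction ts arbitrary: b) (auto simp: dc_def)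

lemma dc_Node: "dc (Node s ts) = s # concat (map dc ts)"
  using map_snd_internalss[of 1 ts] by (simp add: dc_def internals_Node)

lemma dc_Leaf [simp]: "dc Leaf = []"
  by (simp add: dc_def)

lemma is_term_iff: "is_term A ar t \<longleftrightarrow> is_term UNIV ar t \<and> set (dc t) \<subseteq> A"
  by (induction t) (auto simp: dc_Node)

section \<open>Parent edges\<close>

text \<open>This is the order of the values of \<^const>\<open>cnc\<close>, where a position further left is larger.\<close>

definition edge_le :: "nat \<times> nat \<Rightarrow> nat \<times> nat \<Rightarrow> bool" where
  "edge_le e e' \<longleftrightarrow> fst e < fst e' \<or> fst e = fst e' \<and> snd e' \<le> snd e"

definition edge_less :: "nat \<times> nat \<Rightarrow> nat \<times> nat \<Rightarrow> bool" where
  "edge_less e e' \<longleftrightarrow> fst e < fst e' \<or> fst e = fst e' \<and> snd e' < snd e"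

text \<open>Nodes are numbered from 0 here, so node \<open>i\<close> is node \<open>Suc i\<close>
  for \<open>pa\<close> and \<open>lp\<close>, and the parent is shifted back accordingly.\<close>

definition edge :: "'d tm \<Rightarrow> nat \<Rightarrow> nat \<times> nat" where
  "edge t i = (pa t (Suc i) - 1, lp t (Suc i))"

lemma less_append_Cons: "(a :: nat list) < a @ l # r"
  by (induction a) auto

lemma append_Cons_less: "l' < l \<Longrightarrow> (a :: nat list) @ l' # r < a @ [l]"
  by (induction a) auto

text \<open>In a term, the nodes visited strictly between a node and its \<open>l\<close>-th child
  lie in the subterms of its earlier children.\<close>

lemma between_append:
  "(a :: nat list) < b \<Longrightarrow> b < a @ [l] \<Longrightarrow> \<exists>l' r. l' < l \<and> b = a @ l' # r"
proof (induction a arbitrary: b)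
  case Nil
  then show ?case by (cases b) auto
next
  case (Cons x a)
  then obtain b' where "b = x # b'" by (cases b) auto
  with Cons show ?case by auto
qed

lemma obtain_parent:
  assumes "is_term A ar t" "0 < i" "i < deg t"
  obtains p l where "p < i" "1 \<le> l" "l \<le> ar (dc t ! p)" "addrs t ! i = addrs t ! p @ [l]"
    "pa t (Suc i) = Suc p" "lp t (Suc i) = l"
proof -
  have ne: "addrs t ! i \<noteq> []" using assms addrs_Nil_iff by blast
  then obtain q l where q: "addrs t ! i = q @ [l]" by (metis append_butlast_last_id)
  have "(q @ [l], Some (dc t ! i)) \<in> set (traversal t)" using dc_addrs[OF assms(3)] q by simp
  from traversal_parent[OF this assms(1)]
  obtain s where s: "(q, Some s) \<in> set (traversal t)" "1 \<le> l" "l \<le> ar s" by blast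
  then have "(q, s) \<in> set (internals t)" by (simp add: in_internals_iff)
  then obtain p where p: "p < deg t" "addrs t ! p = q" "dc t ! p = s"
    by (auto simp: in_set_conv_nth internals_eq_zip)
  have "addrs t ! p < addrs t ! i" using p q less_append_Cons by simp
  then have "p < i" using addrs_less_iff assms p by blast
  have address: "k \<in> {1..deg t} \<and> address t k = butlast (address t (Suc i)) \<longleftrightarrow>
      k \<in> {1..deg t} \<and> addrs t ! (k - 1) = addrs t ! p" for k
    using assms p q by (auto simp: address_def addrs_def)
  have "pa t (Suc i) = (THE k. k \<in> {1..deg t} \<and> addrs t ! (k - 1) = addrs t ! p)"
    unfolding pa_def address using assms(2) by simp
  also have "\<dots> = Suc p"
  \<comment> \<open>Distinctness of the addresses makes the definite description in
    \<open>pa\<close> well defined.\<close>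
  proof (rule the_equality)
    fix k assume k: "k \<in> {1..deg t} \<and> addrs t ! (k - 1) = addrs t ! p"
    then have "k - 1 < deg t" by (cases k) auto
    with k p addrs_eq_iff[of "k - 1" t p] show "k = Suc p" by (cases k) auto
  next
    show "Suc p \<in> {1..deg t} \<and> addrs t ! (Suc p - 1) = addrs t ! p" using p by simp
  qed
  finally have "pa t (Suc i) = Suc p" .
  moreover have "lp t (Suc i) = l"
    using assms q by (simp add: lp_def address_def addrs_def)
  ultimately show ?thesis using that \<open>p < i\<close> s p q by blast
qed

text \<open>This disposes of the definite description in \<open>pa\<close>: from here on edges are
  read off from addresses.\<close>

lemma edge_eq_iff:
  assumes "is_term A ar t" "0 < i" "i < deg t"
  shows "edge t i = (p, l) \<longleftrightarrow> p < deg t \<and> addrs t ! i = addrs t ! p @ [l]"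
proof -
  obtain p' l' where *: "p' < i" "addrs t ! i = addrs t ! p' @ [l']"
    "pa t (Suc i) = Suc p'" "lp t (Suc i) = l'"
    using obtain_parent[OF assms] by metis
  then have "edge t i = (p, l) \<longleftrightarrow> p = p' \<and> l = l'" by (auto simp: edge_def)
  also have "\<dots> \<longleftrightarrow> p < deg t \<and> addrs t ! i = addrs t ! p @ [l]"
    using * assms addrs_eq_iff[of p t p'] by auto
  finally show ?thesis .
qed

lemma obtain_edge:
  assumes "is_term A ar t" "0 < i" "i < deg t"
  obtains p l where "edge t i = (p, l)" "p < i" "1 \<le> l" "l \<le> ar (dc t ! p)"
    "addrs t ! i = addrs t ! p @ [l]"
proof -
  obtain p l where *: "p < i" "1 \<le> l" "l \<le> ar (dc t ! p)" "addrs t ! i = addrs t ! p @ [l]"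
    "pa t (Suc i) = Suc p" "lp t (Suc i) = l"
    using obtain_parent[OF assms] by metis
  then show ?thesis using that[of p l] by (simp add: edge_def)
qed

text \<open>Node \<open>j\<close> lies in the subterm of a child of \<open>p\<close> to the left of
  position \<open>l\<close>. Either it is that child, with the same parent and a smaller position,
  or its parent is a proper descendant of \<open>p\<close> and has a larger number; both make the
  edge larger.\<close>

lemma edge_less_edge:
  assumes t: "is_term A ar t" and j: "p < j" "j < deg t" and less: "addrs t ! j < addrs t ! p @ [l]"
  shows "edge_less (p, l) (edge t j)"
proof -
  have "addrs t ! p < addrs t ! j" using addrs_less_iff[of p t j] j by simp
  from between_append[OF this less] obtain l' r
    where r: "l' < l" "addrs t ! j = addrs t ! p @ l' # r" by blast
  have "0 < j" using j by simp
  from obtain_edge[OF t this j(2)] obtain p' k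
    where e: "edge t j = (p', k)" "p' < j" "addrs t ! j = addrs t ! p' @ [k]" by metis
  show ?thesis
  proof (cases r rule: rev_cases)
    case Nil
    then have "addrs t ! p' = addrs t ! p" "k = l'" using r e by auto
    then show ?thesis using addrs_eq_iff[of p' t p] e j r by (auto simp: edge_less_def)
  next
    case (snoc r' x)
    then have "addrs t ! p' = addrs t ! p @ l' # r'"
      using r e by (metis append_Cons append_assoc append_same_eq butlast_snoc)
    then have "addrs t ! p < addrs t ! p'" by (simp add: less_append_Cons)
    then show ?thesis using addrs_less_iff[of p t p'] e j by (auto simp: edge_less_def)
  qed
qed

text \<open>Converse of \<open>edge_less_edge\<close>. Following parents, each node after
  \<open>p\<close> is found below an earlier child of \<open>p\<close>; the nodes up to
  \<open>p\<close> precede every child of \<open>p\<close> anyway.\<close>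

lemma addrs_less_if_edge_less:
  assumes t: "is_term A ar t" and p: "p < deg t"
    and less: "\<And>j. p < j \<Longrightarrow> j < deg t \<Longrightarrow> edge_less (p, l) (edge t j)"
    and j: "j < deg t"
  shows "addrs t ! j < addrs t ! p @ [l]"
proof (cases "p < j")
  case True
  \<comment> \<open>The explicit form of a descendant is inherited from parent to child.\<close>
  have "\<exists>l' r. l' < l \<and> addrs t ! j = addrs t ! p @ l' # r"
    using True j
  proof (induction j rule: less_induct)
    case (less j)
    then have "0 < j" by simp
    from obtain_edge[OF t this less(3)] obtain p' k
      where e: "edge t j = (p', k)" "p' < j" "addrs t ! j = addrs t ! p' @ [k]" by metis
    from assms(3)[OF less(2,3)] e consider "p < p'" | "p = p'" "k < l"
      by (auto simp: edge_less_def)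
    then show ?case
    proof cases
      case 1
      with less.IH[of p'] e less.prems obtain l' r
        where "l' < l" "addrs t ! p' = addrs t ! p @ l' # r" by auto
      then show ?thesis using e by (intro exI[of _ l'] exI[of _ "r @ [k]"]) simp
    qed (use e in auto)
  qed
  then show ?thesis using append_Cons_less by auto
next
  case False
  then have "addrs t ! j \<le> addrs t ! p"
    using addrs_less_iff[of p t j] p j by (meson leI)
  also have "\<dots> < addrs t ! p @ [l]" by (rule less_append_Cons)
  finally show ?thesis .
qed

section \<open>The numbers \<open>cnc\<close> as an encoding of parent edges\<close>

lemma cnc_eq:
  assumes "is_term A ar t" "0 < i" "i < deg t" "edge t i = (p, l)"
  shows "cnc ar t (Suc i) = real p + 2 - 2 powi (int l - int (ar (dc t ! p)))"
proof -
  obtain p' l' where *: "p' < i" "pa t (Suc i) = Suc p'" "lp t (Suc i) = l'"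
    using obtain_parent[OF assms(1-3)] by metis
  then have "p' = p" "l' = l" using assms(4) by (auto simp: edge_def)
  \<comment> \<open>The 2 combines the \<open>+ 1\<close> in \<open>cnc\<close> with the shift from
    node \<open>p\<close> to number \<open>Suc p\<close>.\<close>
  then show ?thesis using * by (simp add: cnc_def decoration_def)
qed

lemma powi_sub_le_1: "l \<le> a \<Longrightarrow> 2 powi (int l - int a) \<le> (1 :: real)"
  using power_int_increasing[of "int l - int a" 0 "2 :: real"] by simp

text \<open>The subtracted power lies in the half-open interval from 0 (excluded) to 1, so the
  integer part of \<open>cnc\<close> is determined by the parent. For equal parents the arities
  agree since the words do, and a larger position subtracts more.\<close>

lemma cnc_le_iff:
  assumes t: "is_term A ar t" "is_term B ar t'" "dc t = dc t'" "0 < i" "i < deg t"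
  shows "cnc ar t (Suc i) \<le> cnc ar t' (Suc i) \<longleftrightarrow> edge_le (edge t i) (edge t' i)"
proof -
  have deg: "deg t' = deg t" using t(3) by (metis length_dc)
  obtain p l where e: "edge t i = (p, l)" "l \<le> ar (dc t ! p)"
    using obtain_edge[OF t(1,4,5)] by metis
  obtain p' l' where e': "edge t' i = (p', l')" "l' \<le> ar (dc t ! p')"
    using obtain_edge[OF t(2,4)] t deg by metis
  let ?x = "2 powi (int l - int (ar (dc t ! p))) :: real"
  let ?y = "2 powi (int l' - int (ar (dc t ! p'))) :: real"
  have xy: "0 < ?x" "?x \<le> 1" "0 < ?y" "?y \<le> 1"
    using e e' by (auto intro: powi_sub_le_1)
  have c: "cnc ar t (Suc i) = real p + 2 - ?x" "cnc ar t' (Suc i) = real p' + 2 - ?y"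
    using cnc_eq[OF t(1,4,5) e(1)] cnc_eq[OF t(2,4) _ e'(1)] t deg by auto
  consider "p < p'" | "p' < p" | "p = p'" by linarith
  then show ?thesis
  proof cases
    case 1
    then have "real p + 1 \<le> real p'" by linarith
    then have "cnc ar t (Suc i) \<le> cnc ar t' (Suc i)" unfolding c using xy by linarith
    then show ?thesis using 1 e e' by (simp add: edge_le_def)
  next
    case 2
    then have "real p' + 1 \<le> real p" by linarith
    then have "\<not> cnc ar t (Suc i) \<le> cnc ar t' (Suc i)" unfolding c using xy by linarith
    then show ?thesis using 2 e e' by (simp add: edge_le_def)
  next
    case 3
    have "?y \<le> ?x \<longleftrightarrow> l' \<le> l"
    proof
      assume "l' \<le> l"
      then show "?y \<le> ?x" unfolding 3 by (intro power_int_increasing) auto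
    next
      assume "?y \<le> ?x"
      moreover have "?x < ?y" if "l < l'"
        unfolding 3 using that by (intro power_int_strict_increasing) auto
      ultimately show "l' \<le> l" by force
    qed
    then show ?thesis unfolding c using 3 e e' by (simp add: edge_le_def)
  qed
qed

lemma tm_le_iff:
  assumes t: "is_term A ar t" "is_term B ar t'"
  shows "tm_le ar t t' \<longleftrightarrow>
    dc t = dc t' \<and> (\<forall>i. 0 < i \<and> i < deg t \<longrightarrow> edge_le (edge t i) (edge t' i))"
proof -
  have "(\<forall>i\<in>{1..deg t}. cnc ar t i \<le> cnc ar t' i) \<longleftrightarrow>
    (\<forall>i. 0 < i \<and> i < deg t \<longrightarrow> edge_le (edge t i) (edge t' i))" if dc: "dc t = dc t'"
  proof -
    \<comment> \<open>The conventions for \<open>pa\<close> and \<open>lp\<close> at the root make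
      its value depend on the decorations only.\<close>
    have "cnc ar t (Suc 0) = cnc ar t' (Suc 0)"
      using dc by (simp add: cnc_def pa_def lp_def decoration_def)
    then have "(\<forall>i\<in>{1..deg t}. cnc ar t i \<le> cnc ar t' i) \<longleftrightarrow>
      (\<forall>i. 0 < i \<and> i < deg t \<longrightarrow> cnc ar t (Suc i) \<le> cnc ar t' (Suc i))"
      by (auto simp: Ball_def) (metis Suc_le_D Suc_le_eq gr0I order_refl)
    then show ?thesis using cnc_le_iff[OF t dc] by auto
  qed
  then show ?thesis unfolding tm_le_def by blast
qed

section \<open>Grafting at extreme leaves\<close>

definition graft_node :: "(nat list \<Rightarrow> 'd tm) \<Rightarrow> nat list \<times> 'd option \<Rightarrow> (nat list \<times> 'd option) list"
  where "graft_node g n = (case n of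
      (p, None) \<Rightarrow> map (apfst ((@) p)) (traversal (g p)) | (p, Some s) \<Rightarrow> [(p, Some s)])"

lemma traversal_graft: "traversal (graft t g) = concat (map (graft_node g) (traversal t))"
proof (induction t arbitrary: g)
  case Leaf
  have "apfst ((@) []) = (id :: nat list \<times> 'a option \<Rightarrow> _)" by auto
  then show ?case by (simp add: graft_node_def)
next
  case (Node s ts)
  have *: "concat (map (graft_node g \<circ> apfst (Cons b)) ns) =
      map (apfst (Cons b)) (concat (map (graft_node (\<lambda>p. g (b # p))) ns))" for b g
    and ns :: "(nat list \<times> 'a option) list"
    by (induction ns) (auto simp: graft_node_def split: option.splits)
  have "traversals b (map (\<lambda>(j, h). h (\<lambda>p. g (j # p))) (enumerate b (map graft ts))) =
      concat (map (graft_node g) (traversals b ts))" for b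
    using Node.IH by (induction ts arbitrary: b) (simp_all add: *)
  then show ?case
    by (simp add: traversal_Node) (simp add: graft_node_def)
qed

lemma is_term_graft:
  "is_term A ar t \<Longrightarrow> (\<And>p. is_term A ar (g p)) \<Longrightarrow> is_term A ar (graft t g)"
proof (induction t arbitrary: g)
  case (Node s ts)
  have "is_term A ar (graft (ts ! i) (\<lambda>p. g (Suc i # p)))" if "i < length ts" for i
    using that Node.prems by (intro Node.IH) auto
  with Node.prems show ?case by (auto simp: in_set_conv_nth nth_enumerate_eq)
qed auto

lemma somes_concat: "somes (concat xss) = concat (map somes xss)"
  by (induction xss) auto

text \<open>The extreme leaves are the maximal run of leaves that ends the traversal;
  \<open>xs\<close> is everything up to the last internal node, and is empty if there is
  none.\<close>

lemma obtain_extreme_leaves: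
  obtains xs where "traversal t = xs @ map (\<lambda>p. (p, None)) (extreme_leaves t)"
    "xs = [] \<or> snd (last xs) \<noteq> None"
proof -
  define ns where "ns = traversal t"
  define xs where "xs = rev (dropWhile (\<lambda>n. snd n = None) (rev ns))"
  define ys where "ys = rev (takeWhile (\<lambda>n. snd n = None) (rev ns))"
  have ns: "ns = xs @ ys"
    unfolding xs_def ys_def by (metis rev_append rev_rev_ident takeWhile_dropWhile_id)
  have ys: "\<forall>n\<in>set ys. snd n = None" unfolding ys_def by (auto dest: set_takeWhileD)
  have xs: "xs = [] \<or> snd (last xs) \<noteq> None"
    using hd_dropWhile[of "\<lambda>n. snd n = None" "rev ns"] unfolding xs_def
    by (simp add: last_rev del: dropWhile_eq_Nil_conv) blast
  \<comment> \<open>The last entry of \<open>xs\<close> is internal and no entry of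
    \<open>ys\<close> is, so an index is beyond all internal nodes exactly when it is beyond
    \<open>xs\<close>.\<close>
  have iff: "snd (ns ! k) = None \<and> (\<forall>j<length ns. snd (ns ! j) \<noteq> None \<longrightarrow> j < k) \<longleftrightarrow> length xs \<le> k"
    if k: "k < length ns" for k
  proof
    assume L: "snd (ns ! k) = None \<and> (\<forall>j<length ns. snd (ns ! j) \<noteq> None \<longrightarrow> j < k)"
    show "length xs \<le> k"
    proof (cases "xs = []")
      case False
      then have "snd (ns ! (length xs - 1)) \<noteq> None" using xs ns
        by (simp add: nth_append last_conv_nth)
      moreover have "length xs - 1 < length ns" using ns False by (cases xs) auto
      ultimately show ?thesis using L by fastforce
    qed simp
  next
    assume "length xs \<le> k"
    then show "snd (ns ! k) = None \<and> (\<forall>j<length ns. snd (ns ! j) \<noteq> None \<longrightarrow> j < k)"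
      using ys k unfolding ns by (auto simp: nth_append split: if_splits)
  qed
  have "extreme_leaves t = concat (map (\<lambda>k. if length xs \<le> k then [fst (ns ! k)] else []) [0..<length ns])"
    unfolding extreme_leaves_def Let_def ns_def[symmetric]
    by (intro arg_cong[of _ _ concat] map_cong refl) (use iff in auto)
  also have "[0..<length ns] = [0..<length xs] @ [length xs..<length ns]"
    by (metis le_add1 le_add_same_cancel1 length_append ns upt_add_eq_append zero_le le_add_diff_inverse)
  also have "concat (map (\<lambda>k. if length xs \<le> k then [fst (ns ! k)] else []) \<dots>) =
      concat (map (\<lambda>k. []) [0..<length xs]) @ concat (map (\<lambda>k. [fst (ns ! k)]) [length xs..<length ns])"
    unfolding map_append concat_append
    by (intro arg_cong2[of _ _ _ _ "(@)"] arg_cong[of _ _ concat] map_cong refl) auto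
  also have "\<dots> = map (\<lambda>k. fst (ns ! k)) [length xs..<length ns]" by simp
  also have "\<dots> = map fst ys"
    by (rule nth_equalityI) (auto simp: ns nth_append)
  finally have e: "extreme_leaves t = map fst ys" .
  have "ys = map (\<lambda>p. (p, None)) (map fst ys)"
    using ys by (auto simp: map_idI prod_eq_iff intro!: map_idI[symmetric])
  with e ns have "traversal t = xs @ map (\<lambda>p. (p, None)) (extreme_leaves t)"
    unfolding ns_def by simp
  with that xs show ?thesis by blast
qed

lemma sorted_extreme_leaves: "sorted_wrt (<) (extreme_leaves t)"
proof -
  obtain xs where "traversal t = xs @ map (\<lambda>p. (p, None)) (extreme_leaves t)"
    using obtain_extreme_leaves by blast
  with sorted_traversal[of t] show ?thesis by (simp add: sorted_wrt_append o_def)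
qed

lemma distinct_extreme_leaves: "distinct (extreme_leaves t)"
  using sorted_extreme_leaves strict_sorted_iff by blast

text \<open>As traversals are sorted, being visited after all internal nodes is a comparison of
  addresses, to which the criterion in terms of edges applies.\<close>

lemma in_extreme_leaves_iff:
  "p \<in> set (extreme_leaves t) \<longleftrightarrow>
     (p, None) \<in> set (traversal t) \<and> (\<forall>q\<in>set (addrs t). q < p)"
proof -
  obtain xs where xs: "traversal t = xs @ map (\<lambda>p. (p, None)) (extreme_leaves t)"
    "xs = [] \<or> snd (last xs) \<noteq> None"
    using obtain_extreme_leaves by blast
  have sorted: "\<forall>n\<in>set xs. \<forall>q\<in>set (extreme_leaves t). fst n < q"
    using sorted_traversal[of t] by (auto simp: xs(1) sorted_wrt_append)
  have addrs: "addrs t = map fst (somes xs)"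
    using somes_eq_Nil[of "map (\<lambda>p. (p, None)) (extreme_leaves t)"]
    by (simp add: addrs_def internals_somes xs(1))
  show ?thesis
  proof
    assume p: "p \<in> set (extreme_leaves t)"
    then have "(p, None) \<in> set (traversal t)" unfolding xs(1) by auto
    moreover have "q < p" if "q \<in> set (addrs t)" for q
      using that sorted p unfolding addrs by (fastforce simp: set_somes)
    ultimately show "(p, None) \<in> set (traversal t) \<and> (\<forall>q\<in>set (addrs t). q < p)" by blast
  next
    assume p: "(p, None) \<in> set (traversal t) \<and> (\<forall>q\<in>set (addrs t). q < p)"
    show "p \<in> set (extreme_leaves t)"
    proof (rule ccontr)
      assume "p \<notin> set (extreme_leaves t)"
      with p have in_xs: "(p, None) \<in> set xs" unfolding xs(1) by auto
      then obtain ys q s where ys: "xs = ys @ [(q, Some s)]"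
        using xs(2) by (cases xs rule: rev_cases) auto
      then have "q \<in> set (addrs t)" unfolding addrs by simp
      with p have "q < p" by blast
      moreover have "p < q"
        using in_xs ys sorted_traversal[of t] by (auto simp: xs(1) sorted_wrt_append)
      ultimately show False by simp
    qed
  qed
qed

text \<open>Everything is grafted behind the last internal node of \<open>t\<close>, so the nodes of
  \<open>t\<close> keep their numbers and the grafted ones are appended. Child numbers start from 1
  and list indices from 0, hence \<open>hd q - 1\<close>.\<close>

lemma internals_graft_list:
  assumes "length us = length (extreme_leaves t)"
  shows "internals (graft_list t (extreme_leaves t) us) =
    internals t @ map (apfst (\<lambda>q. extreme_leaves t ! (hd q - 1) @ tl q)) (internalss 1 us)"
proof -
  define ps where "ps = extreme_leaves t"
  define g where "g = (\<lambda>p. case map_of (zip ps us) p of Some u \<Rightarrow> u | None \<Rightarrow> Leaf)"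
  obtain xs where xs: "traversal t = xs @ map (\<lambda>p. (p, None)) ps"
    "xs = [] \<or> snd (last xs) \<noteq> None"
    using obtain_extreme_leaves unfolding ps_def by blast
  have "distinct (map fst (xs @ map (\<lambda>p. (p, None :: 'a option)) ps))"
    using distinct_traversal[of t] xs(1) by simp
  then have dist: "set (map fst xs) \<inter> set ps = {}" "distinct ps" by (auto simp: o_def)
  have len: "length us = length ps" using assms ps_def by simp
  \<comment> \<open>Leaves that are not extreme receive the default \<open>Leaf\<close> and produce
    no new node.\<close>
  have "g p = Leaf" if "p \<notin> set ps" for p
    using that by (auto simp: g_def map_of_eq_None_iff dest: map_of_SomeD set_zip_leftD split: option.splits)
  with dist have "\<forall>n\<in>set xs. somes (graft_node g n) = somes [n]"
    by (fastforce simp: graft_node_def split: option.splits)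
  then have 1: "concat (map (somes \<circ> graft_node g) xs) = somes xs"
    by (induction xs) (auto, metis append_Cons append_Nil somes_append)
  have g: "g (ps ! i) = us ! i" if "i < length ps" for i
    using that dist len by (simp add: g_def map_of_zip_nth)
  have 2: "concat (map (\<lambda>p. map (apfst ((@) p)) (internals (g p))) (drop k ps)) =
      map (apfst (\<lambda>q. ps ! (hd q - 1) @ tl q)) (internalss (Suc k) (drop k us))" for k
  proof (induction "length ps - k" arbitrary: k)
    case 0
    then show ?case using len by simp
  next
    case (Suc m)
    then have k: "k < length ps" by simp
    then have "drop k ps = ps ! k # drop (Suc k) ps" "drop k us = us ! k # drop (Suc k) us"
      using len by (simp_all add: Cons_nth_drop_Suc)
    then show ?case using Suc(1)[of "Suc k"] Suc(2) g[OF k] k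
      by (simp add: apfst_def map_prod_def split_def)
  qed
  have "internals (graft t g) = concat (map (somes \<circ> graft_node g) (traversal t))"
    by (simp add: internals_somes traversal_graft somes_concat)
  also have "\<dots> = somes xs @ concat (map (\<lambda>p. map (apfst ((@) p)) (internals (g p))) ps)"
    by (simp add: xs(1) 1) (simp add: o_def graft_node_def internals_somes)
  also have "somes xs = internals t"
    using somes_eq_Nil[of "map (\<lambda>p. (p, None)) ps"] by (simp add: internals_somes xs(1))
  also have "concat (map (\<lambda>p. map (apfst ((@) p)) (internals (g p))) ps) =
      map (apfst (\<lambda>q. ps ! (hd q - 1) @ tl q)) (internalss 1 us)"
    using 2[of 0] by simp
  finally show ?thesis unfolding graft_list_def ps_def g_def .
qed

lemma is_term_graft_list:
  assumes "is_term A ar t" "\<forall>u\<in>set us. is_term A ar u"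
  shows "is_term A ar (graft_list t ps us)"
  unfolding graft_list_def using assms
  by (intro is_term_graft) (auto dest!: map_of_SomeD set_zip_rightD split: option.splits)

text \<open>Grafting one corolla at an extreme leaf adds a single node, and adds it last; this is
  the elementary step in building forests from codes.\<close>

lemma obtain_snoc:
  assumes t: "is_term A ar t" and p: "p \<in> set (extreme_leaves t)" and s: "s \<in> A"
  obtains t' where "is_term A ar t'" "internals t' = internals t @ [(p, s)]"
proof -
  define ps where "ps = extreme_leaves t"
  obtain i where i: "i < length ps" "ps ! i = p" using p unfolding ps_def by (metis in_set_conv_nth)
  define c where "c = Node s (replicate (ar s) Leaf)"
  define us where "us = replicate i Leaf @ c # replicate (length ps - Suc i) Leaf"
  have "is_term A ar (graft_list t ps us)"
    using t s by (intro is_term_graft_list) (auto simp: us_def c_def)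
  moreover have "length us = length (extreme_leaves t)" using i by (simp add: us_def ps_def)
  from internals_graft_list[OF this]
  have "internals (graft_list t ps us) = internals t @ [(p, s)]"
    using i by (simp add: us_def c_def internals_Node ps_def)
  ultimately show ?thesis using that by blast
qed

section \<open>Codes of leaning forests\<close>

text \<open>
  A nonroot node of a leaning forest is described by its parent edge, except that the position of
  a child of the root, which is determined by the other nodes, is forgotten. Here nodes are
  numbered from 0, so that the root is the node 0.
\<close>

definition code :: "'d tm \<Rightarrow> nat \<Rightarrow> nat \<times> nat" where
  "code t i = (if fst (edge t i) = 0 then (0, 0) else edge t i)"

text \<open>The last conjunct expresses preorder: the position \<open>c i\<close> must be visited
  after all nodes before \<open>i\<close>. It suffices to compare with the nodes between the parent
  and \<open>i\<close>, by \<open>edge_less_edge\<close> and \<open>addrs_less_if_edge_less\<close>.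
  The function \<open>a\<close> gives the arities.\<close>

definition valid_code :: "(nat \<Rightarrow> nat) \<Rightarrow> nat \<Rightarrow> (nat \<Rightarrow> nat \<times> nat) \<Rightarrow> bool" where
  "valid_code a n c \<longleftrightarrow> (\<forall>i. 0 < i \<and> i \<le> n \<longrightarrow> c i = (0, 0) \<or>
     (0 < fst (c i) \<and> fst (c i) < i \<and> 1 \<le> snd (c i) \<and> snd (c i) \<le> a (fst (c i)) \<and>
      (\<forall>j. fst (c i) < j \<and> j < i \<longrightarrow> edge_less (c i) (c j))))"

text \<open>Being fixed by \<open>tlt1\<close>, restated through the internal nodes alone; see
  \<open>tlt1_eq_iff\<close>.\<close>

definition stacked :: "'d tm \<Rightarrow> bool" where
  "stacked t \<longleftrightarrow> (\<forall>m. [Suc (Suc m)] \<in> set (addrs t) \<longrightarrow> [Suc m] \<in> set (addrs t))"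

lemma code_eq_edge: "0 < fst (code t i) \<Longrightarrow> code t i = edge t i"
  by (simp add: code_def split: if_splits)

lemma code_eq_0_iff: "fst (code t i) = 0 \<longleftrightarrow> fst (edge t i) = 0"
  by (simp add: code_def)

lemma code_eq_0: "fst (code t i) = 0 \<Longrightarrow> code t i = (0, 0)"
  by (simp add: code_def split: if_splits)

lemma valid_code_code:
  assumes t: "is_term A ar t"
  shows "valid_code (\<lambda>p. ar (dc t ! p)) (deg t - 1) (code t)"
  unfolding valid_code_def
proof (intro allI impI)
  fix i assume "0 < i \<and> i \<le> deg t - 1"
  then have i: "0 < i" "i < deg t" by auto
  obtain p l where e: "edge t i = (p, l)" "p < i" "1 \<le> l" "l \<le> ar (dc t ! p)"
    "addrs t ! i = addrs t ! p @ [l]"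
    using obtain_edge[OF t i] by metis
  show "code t i = (0, 0) \<or>
     (0 < fst (code t i) \<and> fst (code t i) < i \<and> 1 \<le> snd (code t i) \<and>
      snd (code t i) \<le> ar (dc t ! fst (code t i)) \<and>
      (\<forall>j. fst (code t i) < j \<and> j < i \<longrightarrow> edge_less (code t i) (code t j)))"
  proof (cases "p = 0")
    case False
    then have c: "code t i = (p, l)" using e by (simp add: code_def)
    have "edge_less (p, l) (code t j)" if j: "p < j" "j < i" for j
    proof -
      have "addrs t ! j < addrs t ! p @ [l]"
        using addrs_less_iff[of j t i] i j e by simp
      then have "edge_less (p, l) (edge t j)" using edge_less_edge[OF t] i j by simp
      \<comment> \<open>An edge above one with a positive parent has a positive parent itself, so
        nothing is forgotten in its code.\<close>
      with False show ?thesis by (auto simp: code_def edge_less_def)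
    qed
    with False e c show ?thesis by simp
  qed (use e in \<open>simp add: code_def\<close>)
qed

section \<open>Leaning forests in terms of words and addresses\<close>

lemma singleton_in_addrs_Node:
  "[Suc m] \<in> set (addrs (Node s ts)) \<longleftrightarrow> m < length ts \<and> ts ! m \<noteq> Leaf"
proof -
  have "(\<exists>d. ([], Some d) \<in> set (traversal t)) \<longleftrightarrow> t \<noteq> Leaf" for t :: "'a tm"
    by (cases t) auto
  then show ?thesis by (auto simp: in_addrs_iff)
qed

lemma partition_eq_iff:
  "filter P xs @ filter (\<lambda>x. \<not> P x) xs = xs \<longleftrightarrow>
     (\<forall>m. Suc m < length xs \<and> P (xs ! Suc m) \<longrightarrow> P (xs ! m))"
proof
  assume eq: "filter P xs @ filter (\<lambda>x. \<not> P x) xs = xs"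
  define k where "k = length (filter P xs)"
  have P: "P (xs ! m) \<longleftrightarrow> m < k" if "m < length xs" for m
  proof (cases "m < k")
    case True
    then have "xs ! m = filter P xs ! m" using eq by (metis k_def nth_append)
    with True show ?thesis by (metis k_def nth_mem mem_Collect_eq set_filter)
  next
    case False
    then have "xs ! m = filter (\<lambda>x. \<not> P x) xs ! (m - k)" using eq by (metis k_def nth_append)
    moreover have "m - k < length (filter (\<lambda>x. \<not> P x) xs)"
      using False that eq unfolding k_def by (metis add_diff_inverse_nat length_append nat_add_left_cancel_less)
    ultimately show ?thesis using False by (metis nth_mem mem_Collect_eq set_filter)
  qed
  show "\<forall>m. Suc m < length xs \<and> P (xs ! Suc m) \<longrightarrow> P (xs ! m)" using P by auto
next
  show "\<forall>m. Suc m < length xs \<and> P (xs ! Suc m) \<longrightarrow> P (xs ! m) \<Longrightarrow>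
    filter P xs @ filter (\<lambda>x. \<not> P x) xs = xs"
  proof (induction xs)
    case (Cons x xs)
    have IH: "filter P xs @ filter (\<lambda>x. \<not> P x) xs = xs"
      using Cons.prems by (intro Cons.IH) (metis Suc_less_eq length_Cons nth_Cons_Suc)
    show ?case
    proof (cases "P x")
      case False
      have "\<not> P ((x # xs) ! m)" if "m < length (x # xs)" for m
        using that False by (induction m) (use Cons.prems in auto)
      then have "\<forall>y\<in>set (x # xs). \<not> P y" by (metis in_set_conv_nth)
      then show ?thesis by (auto simp: filter_id_conv)
    qed (use IH in simp)
  qed simp
qed

lemma tlt1_eq_iff: "tlt1 (Node s ts) = Node s ts \<longleftrightarrow> stacked (Node s ts)"
  using partition_eq_iff[of "\<lambda>t. t \<noteq> Leaf" ts]
  by (auto simp: stacked_def singleton_in_addrs_Node)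

text \<open>Balance says that the root decoration is the length of the rest of the word, and
  membership in \<open>S\<close> concerns the word only. Once the word is fixed, only a well-formed
  stacked shape remains to be chosen.\<close>

lemma leaning_iff:
  "leaning S ar F \<longleftrightarrow> is_term UNIV (ext_arity ar) F \<and> stacked F \<and>
     (\<exists>w. dc F = Inr (length w) # w \<and> set w \<subseteq> Inl ` S)"
proof
  assume F: "leaning S ar F"
  then obtain ts where ts: "F = Node (Inr (length ts)) ts"
    "\<forall>t\<in>set ts. is_term (Inl ` S) (ext_arity ar) t"
    by (auto simp: leaning_def balanced_def is_forest_def)
  define w where "w = concat (map dc ts)"
  have "length w = length ts"
    using F ts(1) unfolding w_def leaning_def balanced_def deg_def
    by (simp add: dc_Node del: length_dc) 
  moreover have "set w \<subseteq> Inl ` S" "is_term UNIV (ext_arity ar) F"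
    using ts is_term_iff[of "Inl ` S" "ext_arity ar"] by (auto simp: w_def ext_arity_def)
  moreover have "stacked F" using F ts(1) unfolding leaning_def by (metis tlt1_eq_iff)
  ultimately show "is_term UNIV (ext_arity ar) F \<and> stacked F \<and>
      (\<exists>w. dc F = Inr (length w) # w \<and> set w \<subseteq> Inl ` S)"
    using ts(1) by (auto simp: dc_Node w_def)
next
  assume F: "is_term UNIV (ext_arity ar) F \<and> stacked F \<and>
     (\<exists>w. dc F = Inr (length w) # w \<and> set w \<subseteq> Inl ` S)"
  then obtain w where w: "dc F = Inr (length w) # w" "set w \<subseteq> Inl ` S" by blast
  obtain s ts where F': "F = Node s ts" using w(1) by (cases F) auto
  with w(1) have "s = Inr (length w)" and concat: "concat (map dc ts) = w"
    by (simp_all add: dc_Node)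
  with F' have ts: "F = Node (Inr (length w)) ts" by simp
  have "is_term UNIV (ext_arity ar) F" using F by blast
  then have "length ts = length w" unfolding ts by (simp add: ext_arity_def)
  moreover have "is_term (Inl ` S) (ext_arity ar) t" if "t \<in> set ts" for t
  proof -
    have "set (dc t) \<subseteq> Inl ` S" using w(2) that unfolding concat[symmetric] by auto
    moreover have "is_term UNIV (ext_arity ar) t"
      using \<open>is_term UNIV (ext_arity ar) F\<close> that unfolding ts by simp
    ultimately show ?thesis using is_term_iff by blast
  qed
  ultimately have "is_forest S ar F" unfolding is_forest_def using ts by blast
  moreover have "deg F = length w + 1" using arg_cong[OF w(1), of length] by simp
  moreover have "root_arity F = length w" using arg_cong[OF ts, of root_arity] by simp
  moreover have "tlt1 F = F"
    using F tlt1_eq_iff[of "Inr (length w)" ts] unfolding ts[symmetric] by blast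
  ultimately show "leaning S ar F" unfolding leaning_def balanced_def by simp
qed

text \<open>The internal children of the root fill its positions from the left without gaps and are
  numbered in that order, so counting recovers the position that \<open>code\<close>
  forgets.\<close>

lemma card_root_children:
  assumes t: "is_term A ar t" and "stacked t" and i: "0 < i" "i < deg t" and e: "edge t i = (0, l)"
  shows "card {j. 0 < j \<and> j \<le> i \<and> fst (edge t j) = 0} = l"
proof -
  let ?J = "{j. 0 < j \<and> j \<le> i \<and> fst (edge t j) = 0}"
  have addr: "addrs t ! j = [m]" if "edge t j = (0, m)" "0 < j" "j < deg t" for j m
    using edge_eq_iff[OF t that(2,3), of 0 m] that by simp
  have "bij_betw (\<lambda>j. snd (edge t j)) ?J {1..l}"
    unfolding bij_betw_def
  proof
    show "inj_on (\<lambda>j. snd (edge t j)) ?J"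
    proof (rule inj_onI)
      fix j k assume *: "j \<in> ?J" "k \<in> ?J" "snd (edge t j) = snd (edge t k)"
      then have "edge t j = (0, snd (edge t j))" "edge t k = (0, snd (edge t j))"
        by (auto simp: prod_eq_iff)
      moreover have jk: "0 < j" "j < deg t" "0 < k" "k < deg t" using *(1,2) i by auto
      ultimately have "addrs t ! j = addrs t ! k" using addr[of j] addr[of k] by metis
      then show "j = k" using addrs_eq_iff[of j t k] jk by simp
    qed
    show "(\<lambda>j. snd (edge t j)) ` ?J = {1..l}"
    proof (intro equalityI subsetI)
      fix m assume "m \<in> (\<lambda>j. snd (edge t j)) ` ?J"
      then obtain j where "j \<in> ?J" "m = snd (edge t j)" by blast
      then have j: "0 < j" "j \<le> i" "edge t j = (0, m)" by (simp_all add: prod_eq_iff)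
      then have "addrs t ! j = [m]" "addrs t ! i = [l]" using addr[of j m] addr[of i l] i e by auto
      then have "m \<le> l" using addrs_less_iff[of i t j] j i by auto
      moreover have "1 \<le> m" using obtain_edge[OF t, of j] j i by (metis le_less_trans prod.inject)
      ultimately show "m \<in> {1..l}" by simp
    next
      fix m assume m: "m \<in> {1..l}"
      \<comment> \<open>Walking left from position \<open>l\<close>, stackedness supplies each
        neighbour.\<close>
      have "[l - k] \<in> set (addrs t)" if "k < l" for k
        using that
      proof (induction k)
        case 0
        then show ?case using addr[OF e i] i by (metis diff_zero length_addrs nth_mem)
      next
        case (Suc k)
        then have "l - k = Suc (Suc (l - Suc k - 1))" "l - Suc k = Suc (l - Suc k - 1)" by simp_all
        then show ?case using Suc assms(2) unfolding stacked_def by (metis Suc_lessD)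
      qed
      from this[of "l - m"] m have "[m] \<in> set (addrs t)" by auto
      then obtain j where j: "j < deg t" "addrs t ! j = [m]" by (metis in_set_conv_nth length_addrs)
      have "0 < j" using j by (cases j) auto
      moreover have "j \<le> i" using addrs_less_iff[of i t j] j i addr[OF e i] m by auto
      moreover have "edge t j = (0, m)" using edge_eq_iff[OF t \<open>0 < j\<close> j(1)] j i by simp
      ultimately show "m \<in> (\<lambda>j. snd (edge t j)) ` ?J"
        using \<open>0 < j\<close> by (intro image_eqI[of _ _ j]) simp_all
    qed
  qed
  then show ?thesis by (simp add: bij_betw_same_card)
qed

text \<open>Forgetting loses nothing: if the codes of \<open>t\<close> are below those of
  \<open>t'\<close>, root children of \<open>t'\<close> are root children of \<open>t\<close>. Hence
  the counts, which are the forgotten positions, are at least as large in \<open>t\<close>, and a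
  larger position is a smaller edge.\<close>

lemma tm_le_iff_code:
  assumes t: "is_term A ar t" "is_term B ar t'" and stacked: "stacked t" "stacked t'"
  shows "tm_le ar t t' \<longleftrightarrow>
    dc t = dc t' \<and> (\<forall>i. 0 < i \<and> i < deg t \<longrightarrow> edge_le (code t i) (code t' i))"
proof -
  have "(\<forall>i. 0 < i \<and> i < deg t \<longrightarrow> edge_le (edge t i) (edge t' i)) \<longleftrightarrow>
    (\<forall>i. 0 < i \<and> i < deg t \<longrightarrow> edge_le (code t i) (code t' i))" if dc: "dc t = dc t'"
  proof (intro iffI allI impI)
    fix i
    assume *: "\<forall>i. 0 < i \<and> i < deg t \<longrightarrow> edge_le (edge t i) (edge t' i)" "0 < i \<and> i < deg t"
    then have "edge_le (edge t i) (edge t' i)" by blast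
    then show "edge_le (code t i) (code t' i)" by (auto simp: code_def edge_le_def)
  next
    fix i
    assume *: "\<forall>i. 0 < i \<and> i < deg t \<longrightarrow> edge_le (code t i) (code t' i)"
      and i: "0 < i \<and> i < deg t"
    have deg: "deg t' = deg t" using dc by (metis length_dc)
    show "edge_le (edge t i) (edge t' i)"
    proof (cases "fst (edge t i) = 0 \<and> fst (edge t' i) = 0")
      case True
      then obtain l l' where l: "edge t i = (0, l)" "edge t' i = (0, l')"
        by (metis prod.collapse)
      have "fst (edge t j) = 0" if "0 < j" "j < deg t" "fst (edge t' j) = 0" for j
        using * that by (auto simp: code_def edge_le_def split: if_splits)
      then have "{j. 0 < j \<and> j \<le> i \<and> fst (edge t' j) = 0} \<subseteq> {j. 0 < j \<and> j \<le> i \<and> fst (edge t j) = 0}"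
        using i by auto
      then have "card {j. 0 < j \<and> j \<le> i \<and> fst (edge t' j) = 0} \<le>
          card {j. 0 < j \<and> j \<le> i \<and> fst (edge t j) = 0}"
        by (intro card_mono) simp_all
      then have "l' \<le> l"
        using card_root_children[OF t(1) stacked(1) _ _ l(1)]
          card_root_children[OF t(2) stacked(2) _ _ l(2)] i deg by simp
      with l show ?thesis by (simp add: edge_le_def)
    next
      case False
      have "edge_le (code t i) (code t' i)" using * i by blast
      with False show ?thesis by (auto simp: code_def edge_le_def split: if_splits)
    qed
  qed
  then show ?thesis unfolding tm_le_iff[OF t] by blast
qed

lemma edge_le_refl [simp]: "edge_le e e"
  by (simp add: edge_le_def)

lemma edge_le_antisym: "edge_le e e' \<Longrightarrow> edge_le e' e \<Longrightarrow> e = e'"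
  by (auto simp: edge_le_def prod_eq_iff)

lemma edge_less_le_trans: "edge_less e e' \<Longrightarrow> edge_le e' e'' \<Longrightarrow> edge_less e e''"
  by (auto simp: edge_le_def edge_less_def)

text \<open>Equal edges give equal addresses, from the root downwards, and addresses with
  decorations determine the term.\<close>

lemma tm_le_antisym:
  assumes t: "is_term A ar t" "is_term B ar t'" and le: "tm_le ar t t'" "tm_le ar t' t"
  shows "t = t'"
proof -
  have dc: "dc t = dc t'" using le by (simp add: tm_le_def)
  then have deg: "deg t' = deg t" by (metis length_dc)
  have edge: "edge t i = edge t' i" if "0 < i" "i < deg t" for i
    using le that deg unfolding tm_le_iff[OF t] tm_le_iff[OF t(2,1)]
    by (auto intro: edge_le_antisym)
  have "addrs t ! i = addrs t' ! i" if "i < deg t" for i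
    using that
  proof (induction i rule: less_induct)
    case (less i)
    show ?case
    proof (cases "i = 0")
      case True
      then show ?thesis using less deg by simp
    next
      case False
      then obtain p l where p: "edge t i = (p, l)" "p < i" "addrs t ! i = addrs t ! p @ [l]"
        using obtain_edge[OF t(1) _ less(2)] by (metis gr0I)
      then have "addrs t' ! i = addrs t' ! p @ [l]"
        using edge_eq_iff[OF t(2), of i p l] edge[of i] less False deg by simp
      then show ?thesis using less.IH[of p] p less(2) by simp
    qed
  qed
  then have "addrs t = addrs t'" using deg by (intro nth_equalityI) auto
  with term_eqI[OF t _ dc] show ?thesis by blast
qed

lemma code_inj:
  assumes t: "is_term A ar t" "is_term B ar t'" and stacked: "stacked t" "stacked t'"
    and eq: "dc t = dc t'" "\<And>i. 0 < i \<Longrightarrow> i < deg t \<Longrightarrow> code t i = code t' i"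
  shows "t = t'"
proof (rule tm_le_antisym[OF t])
  have "deg t' = deg t" using eq(1) by (metis length_dc)
  then show "tm_le ar t t'" "tm_le ar t' t"
    using eq unfolding tm_le_iff_code[OF t stacked] tm_le_iff_code[OF t(2,1) stacked(2,1)]
    by auto
qed

section \<open>Realising valid codes by leaning forests\<close>

lemma extreme_leafI:
  assumes t: "is_term A ar t" and p: "p < deg t" "1 \<le> l" "l \<le> ar (dc t ! p)"
    and less: "\<And>q. q \<in> set (addrs t) \<Longrightarrow> q < addrs t ! p @ [l]"
  shows "addrs t ! p @ [l] \<in> set (extreme_leaves t)"
proof -
  obtain d where d: "(addrs t ! p @ [l], d) \<in> set (traversal t)"
    using traversal_child[OF dc_addrs[OF p(1)] t p(2,3)] by blast
  have "d = None"
  proof (rule ccontr)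
    assume "d \<noteq> None"
    with d have "addrs t ! p @ [l] \<in> set (addrs t)" by (auto simp: in_addrs_iff)
    with less show False by blast
  qed
  with d less show ?thesis by (simp add: in_extreme_leaves_iff)
qed

lemma hd_in_addrs: "j # r \<in> set (addrs t) \<Longrightarrow> [j] \<in> set (addrs t) \<and> 0 < j"
proof (cases t)
  case (Node s ts)
  assume "j # r \<in> set (addrs t)"
  then obtain i d where "j = Suc i" "i < length ts" "(r, Some d) \<in> set (traversal (ts ! i))"
    unfolding Node by (auto simp: in_addrs_iff)
  then show ?thesis unfolding Node by (auto simp: singleton_in_addrs_Node)
qed (simp add: addrs_def)

lemma stacked_mono: "stacked t \<Longrightarrow> [Suc m] \<in> set (addrs t) \<Longrightarrow> k \<le> m \<Longrightarrow> [Suc k] \<in> set (addrs t)"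
  by (induction m) (auto simp: stacked_def le_Suc_eq)

text \<open>The bound on \<open>m\<close> holds because internal root children are nonroot nodes. It
  is where balance enters: a root with arity the number of all other nodes always has a free
  position for the next one.\<close>

lemma obtain_first_free:
  assumes "stacked t" "0 < deg t"
  obtains m where "m < deg t" "\<And>j. [Suc j] \<in> set (addrs t) \<longleftrightarrow> j < m"
    "\<And>q. q \<in> set (addrs t) \<Longrightarrow> q < [Suc m]"
proof -
  have fin: "finite {j. [Suc j] \<in> set (addrs t)}"
    using finite_vimageI[of "set (addrs t)" "\<lambda>j. [Suc j]"] by (simp add: vimage_def inj_def)
  have "\<exists>j. [Suc j] \<notin> set (addrs t)" 
    using ex_new_if_finite[OF infinite_UNIV_nat fin] by simp
  define k where "k = (LEAST j. [Suc j] \<notin> set (addrs t))"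
  have k: "[Suc j] \<in> set (addrs t) \<longleftrightarrow> j < k" for j
  proof
    assume j: "[Suc j] \<in> set (addrs t)"
    have "[Suc k] \<notin> set (addrs t)"
      unfolding k_def by (rule LeastI_ex) fact
    then show "j < k" using stacked_mono[OF assms(1) j, of k] by (meson leI)
  next
    assume "j < k"
    then show "[Suc j] \<in> set (addrs t)" unfolding k_def using not_less_Least by blast
  qed
  have "(\<lambda>j. [Suc j]) ` {..<k} \<subseteq> set (addrs t) - {[]}" using k by auto
  then have "card ((\<lambda>j. [Suc j]) ` {..<k}) \<le> card (set (addrs t) - {[]})"
    by (intro card_mono) auto
  moreover have "card ((\<lambda>j. [Suc j]) ` {..<k}) = k" by (subst card_image) (auto simp: inj_on_def)
  moreover have "[] \<in> set (addrs t)" using assms(2) by (metis addrs_0 length_addrs nth_mem)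
  then have "card (set (addrs t) - {[]}) = deg t - 1"
    using distinct_card[OF distinct_addrs[of t]] by simp
  ultimately have "k < deg t" using assms(2) by simp
  moreover have "q < [Suc k]" if "q \<in> set (addrs t)" for q
  proof (cases q)
    case (Cons j r)
    with that hd_in_addrs[of j r t] k[of "j - 1"] show ?thesis by auto
  qed simp
  ultimately show ?thesis using that k by blast
qed

text \<open>The root gets its full arity at once, and the nodes are then added in preorder, each at
  an extreme leaf of the term built so far.\<close>

lemma obtain_term_of_code:
  assumes w: "set w \<subseteq> B" and valid: "valid_code (\<lambda>p. ar ((r # w) ! p)) (length w) c"
    and r: "r \<in> B" "ar r = length w" and k: "k \<le> length w"
  shows "\<exists>t. is_term B ar t \<and> dc t = r # take k w \<and> stacked t \<and>
    (\<forall>i. 0 < i \<and> i \<le> k \<longrightarrow> code t i = c i)"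
  using k
proof (induction k)
  case 0
  define t where "t = Node r (replicate (length w) Leaf)"
  have "is_term B ar t" "dc t = [r]" "stacked t"
    using r by (auto simp: t_def dc_Node stacked_def singleton_in_addrs_Node)
  then show ?case by auto
next
  case (Suc k)
  then obtain t where t: "is_term B ar t" "dc t = r # take k w" "stacked t"
    "\<forall>i. 0 < i \<and> i \<le> k \<longrightarrow> code t i = c i" by auto
  have deg: "deg t = Suc k" using t(2) Suc.prems by (metis Suc_leD length_Cons length_dc length_take min.absorb2)
  \<comment> \<open>The place of the next node: beyond all present nodes, so that it is numbered
    last, and, for a root child, the first free position, so that the term stays stacked.\<close>
  have "\<exists>x l. x < deg t \<and> 1 \<le> l \<and> l \<le> ar (dc t ! x) \<and>
      (\<forall>q\<in>set (addrs t). q < addrs t ! x @ [l]) \<and>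
      c (Suc k) = (if x = 0 then (0, 0) else (x, l)) \<and>
      (x = 0 \<longrightarrow> (\<forall>j. Suc j < l \<longrightarrow> [Suc j] \<in> set (addrs t)))"
  proof (cases "c (Suc k) = (0, 0)")
    case True
    obtain m where m: "m < deg t" "\<And>j. [Suc j] \<in> set (addrs t) \<longleftrightarrow> j < m"
      "\<And>q. q \<in> set (addrs t) \<Longrightarrow> q < [Suc m]"
      using obtain_first_free[OF t(3)] deg by auto
    then show ?thesis using True deg t(2) r Suc.prems
      by (intro exI[of _ 0] exI[of _ "Suc m"]) auto
  next
    case False
    obtain x l where xl: "c (Suc k) = (x, l)" by fastforce
    have *: "0 < x" "x < Suc k" "1 \<le> l" "l \<le> ar ((r # w) ! x)"
      and less: "\<And>j. x < j \<Longrightarrow> j < Suc k \<Longrightarrow> edge_less (x, l) (c j)"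
      using valid[unfolded valid_code_def, rule_format, of "Suc k"] False xl Suc.prems by auto
    have "(r # w) ! x = dc t ! x" using * Suc.prems by (simp add: t(2) nth_Cons')
    moreover have "edge_less (x, l) (edge t j)" if "x < j" "j < deg t" for j
    proof -
      have "edge_less (x, l) (code t j)" using less[of j] that t(4) * deg by simp
      with * show ?thesis by (auto simp: code_def edge_less_def split: if_splits)
    qed
    then have "q < addrs t ! x @ [l]" if "q \<in> set (addrs t)" for q
      using addrs_less_if_edge_less[OF t(1), of x l] that * deg by (metis in_set_conv_nth length_addrs)
    ultimately show ?thesis using * xl deg by (intro exI[of _ x] exI[of _ l]) auto
  qed
  then obtain x l where xl: "x < deg t" "1 \<le> l" "l \<le> ar (dc t ! x)"
      "\<forall>q\<in>set (addrs t). q < addrs t ! x @ [l]" "c (Suc k) = (if x = 0 then (0, 0) else (x, l))"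
      "x = 0 \<longrightarrow> (\<forall>j. Suc j < l \<longrightarrow> [Suc j] \<in> set (addrs t))" by blast
  have "addrs t ! x @ [l] \<in> set (extreme_leaves t)"
    using extreme_leafI[OF t(1) xl(1-3)] xl(4) by blast
  moreover have "w ! k \<in> B" using w Suc.prems by auto
  ultimately obtain t' where t': "is_term B ar t'"
    "internals t' = internals t @ [(addrs t ! x @ [l], w ! k)]"
    using obtain_snoc[OF t(1)] by blast
  have dc': "dc t' = r # take (Suc k) w" using t' t(2) Suc.prems
    by (simp add: dc_def take_Suc_conv_app_nth)
  have addrs': "addrs t' = addrs t @ [addrs t ! x @ [l]]" using t' by (simp add: addrs_def)
  have deg': "deg t' = Suc (deg t)" by (metis addrs' length_addrs length_append_singleton)
  have "code t' i = c i" if i: "0 < i" "i \<le> Suc k" for i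
  proof (cases "i = Suc k")
    case True
    then have "edge t' i = (x, l)"
      using edge_eq_iff[OF t'(1), of i x l] i deg deg' addrs' xl(1) by (simp add: nth_append)
    with xl(5) True show ?thesis by (simp add: code_def)
  next
    case False
    then have i': "i < deg t" using i deg by simp
    from obtain_edge[OF t(1) i(1) i'] obtain p m
      where "edge t i = (p, m)" "p < i" "addrs t ! i = addrs t ! p @ [m]" by metis
    then have "edge t' i = edge t i"
      using edge_eq_iff[OF t'(1) i(1), of p m] i' deg' addrs' by (simp add: nth_append)
    then have "code t' i = code t i" by (simp add: code_def)
    with t(4) i False show ?thesis by simp
  qed
  moreover have "stacked t'"
    unfolding stacked_def
  proof (intro allI impI)
    fix m assume "[Suc (Suc m)] \<in> set (addrs t')"
    then consider "[Suc (Suc m)] \<in> set (addrs t)" | "[Suc (Suc m)] = addrs t ! x @ [l]"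
      unfolding addrs' by auto
    then show "[Suc m] \<in> set (addrs t')"
    proof cases
      case 1
      then show ?thesis using t(3) addrs' by (simp add: stacked_def)
    next
      case 2
      then have "addrs t ! x = []" "l = Suc (Suc m)" by auto
      then show ?thesis using xl(6) addrs_Nil_iff[OF xl(1)] addrs' by simp
    qed
  qed
  ultimately show ?case using t'(1) dc' by blast
qed

lemma obtain_leaning:
  assumes "set w \<subseteq> Inl ` S"
    and "valid_code (\<lambda>p. ext_arity ar ((Inr (length w) # w) ! p)) (length w) c"
  obtains F where "leaning S ar F" "dc F = Inr (length w) # w"
    "\<And>i. 0 < i \<Longrightarrow> i \<le> length w \<Longrightarrow> code F i = c i"
proof -
  obtain F where "is_term UNIV (ext_arity ar) F" "dc F = Inr (length w) # w" "stacked F"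
    "\<forall>i. 0 < i \<and> i \<le> length w \<longrightarrow> code F i = c i"
    using obtain_term_of_code[OF _ assms(2), of UNIV "length w"] by (auto simp: ext_arity_def)
  with that show ?thesis using assms(1) unfolding leaning_iff by metis
qed

section \<open>Codes of the over and under products\<close>

lemma internalss_filter_Leaf [simp]: "internalss b (filter (\<lambda>t. t = Leaf) ts) = []"
  by (induction ts arbitrary: b) auto

lemma internalss_shift:
  "internalss (b + k) ts = map (apfst (\<lambda>q. [hd q + k] @ tl q)) (internalss b ts)"
proof (induction ts arbitrary: b)
  case (Cons t ts)
  show ?case using Cons.IH[of "Suc b"] by auto
qed simp

text \<open>
  Both products have this shape: the nodes in the \<open>j\<close>-th child subterm of the root of the second
  forest are moved below the address \<open>f j\<close>.
\<close>

definition joins :: "(nat \<Rightarrow> nat list) \<Rightarrow> 's forest \<Rightarrow> 's forest \<Rightarrow> 's forest \<Rightarrow> bool" where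
  "joins f F\<^sub>1 F\<^sub>2 G \<longleftrightarrow> internals G = ([], Inr (root_arity F\<^sub>1 + root_arity F\<^sub>2)) #
     tl (internals F\<^sub>1) @ map (apfst (\<lambda>q. f (hd q) @ tl q)) (tl (internals F\<^sub>2))"

lemma leaning_Node:
  assumes "leaning S ar F"
  obtains ts where "F = Node (Inr (length ts)) ts" "is_term UNIV (ext_arity ar) F"
    "\<And>t. t \<in> set ts \<Longrightarrow> is_term UNIV (ext_arity ar) t" "stacked F" "deg F = Suc (length ts)"
    "root_arity F = length ts" "filter (\<lambda>t. t \<noteq> Leaf) ts @ filter (\<lambda>t. t = Leaf) ts = ts"
proof -
  from assms obtain ts where ts: "F = Node (Inr (length ts)) ts"
    by (auto simp: leaning_def balanced_def is_forest_def)
  have F: "is_term UNIV (ext_arity ar) F" "stacked F"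
    using assms leaning_iff by blast+
  have "is_term UNIV (ext_arity ar) t" if "t \<in> set ts" for t
  proof -
    have "is_term UNIV (ext_arity ar) (Node (Inr (length ts)) ts)" using F(1) ts by metis
    with that show ?thesis by simp
  qed
  moreover have root: "root_arity F = length ts" using arg_cong[OF ts, of root_arity] by simp
  moreover have "deg F = Suc (length ts)" 
    using assms root unfolding leaning_def balanced_def by simp
  moreover have "tlt1 (Node (Inr (length ts)) ts) = Node (Inr (length ts)) ts"
    using assms ts unfolding leaning_def by metis
  ultimately show ?thesis using that[of ts] ts F by simp
qed

lemma addrs_Cons: "0 < deg t \<Longrightarrow> addrs t = [] # tl (addrs t)"
  by (cases t) (simp_all add: addrs_def internals_Node deg_def del: length_dc)

lemma root_arity_eq: "dc F = Inr n # w \<Longrightarrow> root_arity F = n"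
  by (cases F) (auto simp: dc_Node)

lemma joins_addrs:
  assumes "joins f F\<^sub>1 F\<^sub>2 G" "leaning S ar F\<^sub>1" "leaning S ar F\<^sub>2"
    "dc F\<^sub>1 = Inr n\<^sub>1 # w\<^sub>1" "dc F\<^sub>2 = Inr n\<^sub>2 # w\<^sub>2"
  shows "addrs G = addrs F\<^sub>1 @ map (\<lambda>q. f (hd q) @ tl q) (tl (addrs F\<^sub>2))"
    and "dc G = Inr (n\<^sub>1 + n\<^sub>2) # w\<^sub>1 @ w\<^sub>2"
proof -
  have "0 < deg F\<^sub>1" using arg_cong[OF assms(4), of length] by simp
  then have "addrs F\<^sub>1 = [] # tl (addrs F\<^sub>1)" by (rule addrs_Cons)
  moreover have "addrs G = [] # tl (addrs F\<^sub>1) @ map (\<lambda>q. f (hd q) @ tl q) (tl (addrs F\<^sub>2))"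
    using assms(1) by (simp add: joins_def addrs_def map_tl o_def)
  ultimately show "addrs G = addrs F\<^sub>1 @ map (\<lambda>q. f (hd q) @ tl q) (tl (addrs F\<^sub>2))"
    by (metis append_Cons)
  have "dc G = Inr (n\<^sub>1 + n\<^sub>2) # tl (dc F\<^sub>1) @ tl (dc F\<^sub>2)"
    using assms(1) root_arity_eq[OF assms(4)] root_arity_eq[OF assms(5)]
    by (simp add: joins_def dc_def map_tl o_def)
  then show "dc G = Inr (n\<^sub>1 + n\<^sub>2) # w\<^sub>1 @ w\<^sub>2" using assms(4,5) by simp
qed

lemma joins_over:
  assumes "leaning S ar F\<^sub>1" "leaning S ar F\<^sub>2"
  obtains k where "joins (\<lambda>j. [j + k]) F\<^sub>1 F\<^sub>2 (over_forest F\<^sub>1 F\<^sub>2)"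
proof -
  obtain ts\<^sub>1 where 1: "F\<^sub>1 = Node (Inr (length ts\<^sub>1)) ts\<^sub>1"
    "filter (\<lambda>t. t \<noteq> Leaf) ts\<^sub>1 @ filter (\<lambda>t. t = Leaf) ts\<^sub>1 = ts\<^sub>1"
    using leaning_Node[OF assms(1)] by blast
  obtain ts\<^sub>2 where 2: "F\<^sub>2 = Node (Inr (length ts\<^sub>2)) ts\<^sub>2"
    "filter (\<lambda>t. t \<noteq> Leaf) ts\<^sub>2 @ filter (\<lambda>t. t = Leaf) ts\<^sub>2 = ts\<^sub>2"
    using leaning_Node[OF assms(2)] by blast
  \<comment> \<open>In a leaning forest the leaf children of the root come last, so dropping them
    does not renumber the others.\<close>
  have i: "internalss b (filter (\<lambda>t. t \<noteq> Leaf) ts) = internalss b ts"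
    if "filter (\<lambda>t. t \<noteq> Leaf) ts @ filter (\<lambda>t. t = Leaf) ts = ts" for b and ts :: "'a forest list"
    using arg_cong[OF that, of "internalss b"] by simp
  \<comment> \<open>The subterms of the second forest move past the nonleaf ones of the
    first.\<close>
  let ?k = "length (filter (\<lambda>t. t \<noteq> Leaf) ts\<^sub>1)"
  have "over_forest F\<^sub>1 F\<^sub>2 = Node (Inr (length ts\<^sub>1 + length ts\<^sub>2))
      ((filter (\<lambda>t. t \<noteq> Leaf) ts\<^sub>1 @ filter (\<lambda>t. t \<noteq> Leaf) ts\<^sub>2) @ filter (\<lambda>t. t = Leaf) (ts\<^sub>1 @ ts\<^sub>2))"
    unfolding over_forest_def by (subst 1(1), subst 2(1)) simp
  then have "internals (over_forest F\<^sub>1 F\<^sub>2) = ([], Inr (length ts\<^sub>1 + length ts\<^sub>2)) #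
      internalss 1 ts\<^sub>1 @ internalss (1 + ?k) ts\<^sub>2"
    by (simp only: internals_Node internalss_append internalss_filter_Leaf i[OF 1(2)] i[OF 2(2)]
        append_Nil2)
  also have "internalss (1 + ?k) ts\<^sub>2 = map (apfst (\<lambda>q. [hd q + ?k] @ tl q)) (internalss 1 ts\<^sub>2)"
    by (rule internalss_shift)
  also have "internalss 1 ts\<^sub>1 = tl (internals F\<^sub>1)" by (subst 1(1)) (simp add: internals_Node)
  also have "internalss 1 ts\<^sub>2 = tl (internals F\<^sub>2)" by (subst 2(1)) (simp add: internals_Node)
  also have "length ts\<^sub>1 = root_arity F\<^sub>1" by (subst 1(1)) simp
  also have "length ts\<^sub>2 = root_arity F\<^sub>2" by (subst 2(1)) simp
  finally show ?thesis using that[of ?k] unfolding joins_def by simp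
qed

lemma leaningI:
  assumes "is_term UNIV (ext_arity ar) G" "stacked G" "joins f F\<^sub>1 F\<^sub>2 G"
    and "leaning S ar F\<^sub>1" "leaning S ar F\<^sub>2"
  shows "leaning S ar G"
proof -
  obtain w\<^sub>1 where 1: "dc F\<^sub>1 = Inr (length w\<^sub>1) # w\<^sub>1" "set w\<^sub>1 \<subseteq> Inl ` S"
    using assms(4) leaning_iff by blast
  obtain w\<^sub>2 where 2: "dc F\<^sub>2 = Inr (length w\<^sub>2) # w\<^sub>2" "set w\<^sub>2 \<subseteq> Inl ` S"
    using assms(5) leaning_iff by blast
  have "dc G = Inr (length (w\<^sub>1 @ w\<^sub>2)) # w\<^sub>1 @ w\<^sub>2"
    using joins_addrs(2)[OF assms(3-5) 1(1) 2(1)] by simp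
  moreover have "set (w\<^sub>1 @ w\<^sub>2) \<subseteq> Inl ` S" using 1 2 by simp
  ultimately show ?thesis using assms(1,2) leaning_iff by blast
qed

lemma leaning_over:
  assumes "leaning S ar F\<^sub>1" "leaning S ar F\<^sub>2"
  shows "leaning S ar (over_forest F\<^sub>1 F\<^sub>2)"
proof -
  obtain ts\<^sub>1 where 1: "F\<^sub>1 = Node (Inr (length ts\<^sub>1)) ts\<^sub>1"
    "\<And>t. t \<in> set ts\<^sub>1 \<Longrightarrow> is_term UNIV (ext_arity ar) t"
    using leaning_Node[OF assms(1)] by blast
  obtain ts\<^sub>2 where 2: "F\<^sub>2 = Node (Inr (length ts\<^sub>2)) ts\<^sub>2"
    "\<And>t. t \<in> set ts\<^sub>2 \<Longrightarrow> is_term UNIV (ext_arity ar) t"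
    using leaning_Node[OF assms(2)] by blast
  let ?ts = "ts\<^sub>1 @ ts\<^sub>2"
  have G: "over_forest F\<^sub>1 F\<^sub>2 = Node (Inr (length ?ts))
      (filter (\<lambda>t. t \<noteq> Leaf) ?ts @ filter (\<lambda>t. t = Leaf) ?ts)"
    unfolding over_forest_def by (subst 1(1), subst 2(1)) simp
  have "stacked (over_forest F\<^sub>1 F\<^sub>2)"
    unfolding G by (subst tlt1_eq_iff[symmetric]) (simp add: o_def)
  moreover have "length (filter (\<lambda>t. t \<noteq> Leaf) ?ts) + length (filter (\<lambda>t. t = Leaf) ?ts) = length ?ts"
    using sum_length_filter_compl[of "\<lambda>t. t \<noteq> Leaf" ?ts] by simp
  then have "is_term UNIV (ext_arity ar) (over_forest F\<^sub>1 F\<^sub>2)"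
    unfolding G using 1(2) 2(2) by (auto simp: ext_arity_def)
  moreover obtain k where "joins (\<lambda>j. [j + k]) F\<^sub>1 F\<^sub>2 (over_forest F\<^sub>1 F\<^sub>2)"
    using joins_over[OF assms] .
  ultimately show ?thesis using leaningI assms by blast
qed

text \<open>The \<open>n\<close> added leaves stand to the right of all internal nodes, so all of
  them are extreme. Of the internal nodes only the decoration of the root changes.\<close>

lemma conc_corolla_props:
  fixes F\<^sub>1 :: "'s forest" and n :: nat
  assumes "leaning S ar F\<^sub>1"
  defines "F \<equiv> conc F\<^sub>1 (corolla n)"
  shows "is_term UNIV (ext_arity ar) F"
    and "internals F = ([], Inr (root_arity F\<^sub>1 + n)) # tl (internals F\<^sub>1)"
    and "addrs F = addrs F\<^sub>1" and "stacked F"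
    and "length (extreme_leaves F) = length (extreme_leaves F\<^sub>1) + n"
proof -
  obtain ts where F1: "F\<^sub>1 = Node (Inr (length ts)) ts"
    "\<And>t. t \<in> set ts \<Longrightarrow> is_term UNIV (ext_arity ar) t" "stacked F\<^sub>1" "root_arity F\<^sub>1 = length ts"
    using leaning_Node[OF assms(1)] by blast
  have F: "F = Node (Inr (length ts + n)) (ts @ replicate n Leaf)"
    unfolding F_def corolla_def by (subst F1(1)) simp
  show "is_term UNIV (ext_arity ar) F" unfolding F using F1(2) by (auto simp: ext_arity_def)
  have tl: "tl (internals F\<^sub>1) = internalss 1 ts" by (subst F1(1)) (simp add: internals_Node)
  then show "internals F = ([], Inr (root_arity F\<^sub>1 + n)) # tl (internals F\<^sub>1)"
    unfolding F F1(4) by (simp add: internals_Node)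
  show addrs: "addrs F = addrs F\<^sub>1"
    unfolding F by (subst F1(1)) (simp add: addrs_def internals_Node)
  show "stacked F" using F1(3) unfolding stacked_def addrs .
  have leaf: "(p, None) \<in> set (traversal F) \<longleftrightarrow> (p, None) \<in> set (traversal F\<^sub>1) \<or>
      p \<in> (\<lambda>i. [Suc i]) ` {length ts..<length ts + n}" for p
    unfolding F by (subst F1(1), cases p)
      (auto simp: nth_append image_iff not_less)
  have small: "q < [Suc i]" if "q \<in> set (addrs F\<^sub>1)" "length ts \<le> i" for q i
  proof (cases q)
    case (Cons j r)
    have "q \<in> set (addrs (Node (Inr (length ts)) ts))" using that(1) by (subst F1(1)[symmetric])
    then obtain d where "(j # r, Some d) \<in> set (traversal (Node (Inr (length ts)) ts))"
      unfolding in_addrs_iff Cons by blast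
    then show ?thesis using Cons that(2) by auto
  qed simp
  have disj: "(p, None) \<notin> set (traversal F\<^sub>1)" if "p \<in> (\<lambda>i. [Suc i]) ` {length ts..<length ts + n}" for p
    using that by (subst F1(1)) auto
  have "set (extreme_leaves F) =
      set (extreme_leaves F\<^sub>1) \<union> (\<lambda>i. [Suc i]) ` {length ts..<length ts + n}"
    using small by (auto simp: in_extreme_leaves_iff addrs leaf)
  moreover have "set (extreme_leaves F\<^sub>1) \<inter> (\<lambda>i. [Suc i]) ` {length ts..<length ts + n} = {}"
    using disj by (auto simp: in_extreme_leaves_iff)
  moreover have "card ((\<lambda>i. [Suc i]) ` {length ts..<length ts + n}) = n"
    by (subst card_image) (auto simp: inj_on_def)
  ultimately show "length (extreme_leaves F) = length (extreme_leaves F\<^sub>1) + n"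
    by (simp add: distinct_card[symmetric] distinct_extreme_leaves card_Un_disjoint)
qed

lemma joins_under:
  assumes "leaning S ar F\<^sub>1" "leaning S ar F\<^sub>2"
  defines "ps \<equiv> extreme_leaves (conc F\<^sub>1 (corolla (root_arity F\<^sub>2)))"
  shows "joins (\<lambda>j. ps ! (j - 1)) F\<^sub>1 F\<^sub>2 (under_forest F\<^sub>1 F\<^sub>2)"
    and "is_term UNIV (ext_arity ar) (under_forest F\<^sub>1 F\<^sub>2)"
proof -
  let ?F = "conc F\<^sub>1 (corolla (root_arity F\<^sub>2)) :: 'a forest"
  let ?r = "length (extreme_leaves F\<^sub>1)"
  obtain ts where F2: "F\<^sub>2 = Node (Inr (length ts)) ts"
    "\<And>t. t \<in> set ts \<Longrightarrow> is_term UNIV (ext_arity ar) t" "root_arity F\<^sub>2 = length ts"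
    using leaning_Node[OF assms(2)] by blast
  note F = conc_corolla_props[OF assms(1), of "root_arity F\<^sub>2"]
  have children: "children (conc F\<^sub>2 (corolla ?r)) = ts @ replicate ?r Leaf"
    unfolding corolla_def by (subst F2(1)) simp
  have under: "under_forest F\<^sub>1 F\<^sub>2 = graft_list ?F ps (ts @ replicate ?r Leaf)"
    unfolding under_forest_def Let_def ps_def by (simp only: children)
  show "is_term UNIV (ext_arity ar) (under_forest F\<^sub>1 F\<^sub>2)"
    unfolding under using F(1) F2(2) by (intro is_term_graft_list) auto
  \<comment> \<open>The padding on the two sides makes the number of subterms equal to the number of
    extreme leaves; the padded subterms are leaves and contribute no node.\<close>
  have "length (ts @ replicate ?r Leaf) = length (extreme_leaves ?F)"
    using F(5) F2(3) by simp
  from internals_graft_list[OF this]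
  have "internals (under_forest F\<^sub>1 F\<^sub>2) =
      internals ?F @ map (apfst (\<lambda>q. ps ! (hd q - 1) @ tl q)) (internalss 1 ts)"
    unfolding under by (simp add: ps_def)
  moreover have "internalss 1 ts = tl (internals F\<^sub>2)" by (subst F2(1)) (simp add: internals_Node)
  ultimately show "joins (\<lambda>j. ps ! (j - 1)) F\<^sub>1 F\<^sub>2 (under_forest F\<^sub>1 F\<^sub>2)"
    unfolding joins_def F(2) by simp
qed

lemma under_root_child:
  assumes "leaning S ar F\<^sub>1" "leaning S ar F\<^sub>2" "[j] \<in> set (addrs F\<^sub>2)"
  defines "ps \<equiv> extreme_leaves (conc F\<^sub>1 (corolla (root_arity F\<^sub>2)))"
  shows "0 < j" "j - 1 < length ps"
    "\<exists>x l. x < deg F\<^sub>1 \<and> ps ! (j - 1) = addrs F\<^sub>1 ! x @ [l]"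
proof -
  let ?F = "conc F\<^sub>1 (corolla (root_arity F\<^sub>2)) :: 'a forest"
  obtain ts where F2: "F\<^sub>2 = Node (Inr (length ts)) ts" "root_arity F\<^sub>2 = length ts"
    using leaning_Node[OF assms(2)] by blast
  note F = conc_corolla_props[OF assms(1), of "root_arity F\<^sub>2"]
  show j: "0 < j" using hd_in_addrs assms(3) by blast
  have "[Suc (j - 1)] \<in> set (addrs (Node (Inr (length ts)) ts))" using assms(3) F2(1) j by simp
  then have "j - 1 < length ts" unfolding singleton_in_addrs_Node by blast
  then show len: "j - 1 < length ps" using F(5) F2(2) unfolding ps_def by simp
  let ?p = "ps ! (j - 1)"
  have p: "?p \<in> set (extreme_leaves ?F)" using len by (simp add: ps_def)
  have "0 < deg F\<^sub>1" using leaning_Node[OF assms(1)] by fastforce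
  then have "[] \<in> set (addrs ?F)" unfolding F(3) by (metis addrs_0 length_addrs nth_mem)
  \<comment> \<open>The root is internal, so an extreme leaf comes after it and has a
    parent.\<close>
  with p have "[] < ?p" unfolding in_extreme_leaves_iff by blast
  then obtain q l where ql: "?p = q @ [l]" by (cases ?p rule: rev_cases) auto
  with p have "(q @ [l], None) \<in> set (traversal ?F)" unfolding in_extreme_leaves_iff by simp
  from traversal_parent[OF this F(1)] have "q \<in> set (addrs ?F)" by (auto simp: in_addrs_iff)
  then obtain x where "x < deg F\<^sub>1" "addrs F\<^sub>1 ! x = q"
    unfolding F(3) by (metis in_set_conv_nth length_addrs)
  with ql show "\<exists>x l. x < deg F\<^sub>1 \<and> ?p = addrs F\<^sub>1 ! x @ [l]" by blast
qed

lemma tl_addrs: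
  assumes "q \<in> set (tl (addrs t))"
  obtains j r where "q = j # r" "q \<in> set (addrs t)" "0 < j" "[j] \<in> set (addrs t)"
proof -
  have q: "q \<in> set (addrs t)" using assms by (metis list.set_sel(2) tl_Nil list.distinct(1) empty_iff list.set(1))
  have "0 < deg t" using q by (metis length_addrs length_pos_if_in_set)
  then have "addrs t = [] # tl (addrs t)" by (rule addrs_Cons)
  then have "q \<noteq> []" using distinct_addrs[of t] assms by (metis distinct.simps(2))
  then obtain j r where "q = j # r" by (cases q) auto
  then show ?thesis using that q hd_in_addrs by metis
qed

text \<open>Extreme leaves are filled from the first on. If a subterm lands at a root position, the
  position to its left is either a node already or an extreme leaf visited earlier; the latter
  received an earlier child subterm, which is not a leaf because \<open>F\<^sub>2\<close> is
  stacked.\<close>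

lemma leaning_under:
  assumes F: "leaning S ar F\<^sub>1" "leaning S ar F\<^sub>2"
  shows "leaning S ar (under_forest F\<^sub>1 F\<^sub>2)"
proof -
  let ?F = "conc F\<^sub>1 (corolla (root_arity F\<^sub>2)) :: 'a forest"
  define ps where "ps = extreme_leaves ?F"
  note j = joins_under[OF F, folded ps_def]
  obtain w\<^sub>1 w\<^sub>2 where dc: "dc F\<^sub>1 = Inr (length w\<^sub>1) # w\<^sub>1" "dc F\<^sub>2 = Inr (length w\<^sub>2) # w\<^sub>2"
    using F leaning_iff by blast
  note addrs = joins_addrs(1)[OF j(1) F dc]
  note F' = conc_corolla_props[OF F(1), of "root_arity F\<^sub>2"]
  have stacked2: "stacked F\<^sub>2" using F(2) leaning_iff by blast
  have "stacked (under_forest F\<^sub>1 F\<^sub>2)"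
    unfolding stacked_def
  proof (intro allI impI)
    fix m assume "[Suc (Suc m)] \<in> set (addrs (under_forest F\<^sub>1 F\<^sub>2))"
    then consider "[Suc (Suc m)] \<in> set (addrs ?F)"
      | q where "q \<in> set (tl (addrs F\<^sub>2))" "[Suc (Suc m)] = ps ! (hd q - 1) @ tl q"
      unfolding addrs F'(3) by auto
    then show "[Suc m] \<in> set (addrs (under_forest F\<^sub>1 F\<^sub>2))"
    proof cases
      case 1
      then show ?thesis using F'(4) unfolding stacked_def addrs F'(3) by simp
    next
      case 2
      from tl_addrs[OF 2(1)] obtain i r where i: "q = i # r" "0 < i" "[i] \<in> set (addrs F\<^sub>2)" by metis
      note child = under_root_child[OF F i(3), folded ps_def]
      have "ps ! (i - 1) \<noteq> []" using child(3) by auto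
      then have p: "ps ! (i - 1) = [Suc (Suc m)]" using 2(2) i(1) by (cases "ps ! (i - 1)") auto
      show ?thesis
      proof (cases "[Suc m] \<in> set (addrs ?F)")
        case True
        then show ?thesis unfolding addrs F'(3) by simp
      next
        case False
        have "ps ! (i - 1) \<in> set (extreme_leaves ?F)" using child(2) by (simp add: ps_def)
        then have "([] @ [Suc (Suc m)], None) \<in> set (traversal ?F)"
          unfolding p in_extreme_leaves_iff by simp
        from traversal_parent[OF this F'(1)] obtain s
          where s: "([], Some s) \<in> set (traversal ?F)" "Suc (Suc m) \<le> ext_arity ar s" by blast
        from traversal_child[OF s(1) F'(1), of "Suc m"] s(2) obtain d
          where d: "([Suc m], d) \<in> set (traversal ?F)" by auto
        with False have "d = None" by (cases d) (auto simp: in_addrs_iff)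
        \<comment> \<open>With position \<open>Suc m\<close> not internal, stackedness puts all
          internal root children to its left.\<close>
        moreover have "a < [Suc m]" if "a \<in> set (addrs ?F)" for a
        proof (cases a)
          case (Cons x y)
          with that hd_in_addrs have "[x] \<in> set (addrs ?F)" "0 < x" by blast+
          then have "[Suc (x - 1)] \<in> set (addrs ?F)" by simp
          then have "\<not> m \<le> x - 1" using stacked_mono[OF F'(4)] False by blast
          with Cons show ?thesis by simp
        qed simp
        ultimately have "[Suc m] \<in> set ps" unfolding ps_def in_extreme_leaves_iff using d by simp
        then obtain k where k: "k < length ps" "ps ! k = [Suc m]" by (metis in_set_conv_nth)
        have "k < i - 1"
        proof (rule ccontr)
          assume "\<not> k < i - 1"
          then have "ps ! (i - 1) \<le> ps ! k"
            using sorted_wrt_nth_less[OF sorted_extreme_leaves, of "i - 1" k ?F] k(1) child(2)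
            unfolding ps_def by (cases "k = i - 1") auto
          then show False using p k by simp
        qed
        moreover have "[Suc (i - 1)] \<in> set (addrs F\<^sub>2)" using i by simp
        ultimately have k': "[Suc k] \<in> set (addrs F\<^sub>2)" using stacked_mono[OF stacked2, of "i - 1" k] by fastforce
        have "0 < deg F\<^sub>2" using arg_cong[OF dc(2), of length] by simp
        then have "addrs F\<^sub>2 = [] # tl (addrs F\<^sub>2)" by (rule addrs_Cons)
        with k' have "[Suc k] \<in> set (tl (addrs F\<^sub>2))" by (metis list.distinct(1) set_ConsD)
        then have "ps ! (hd [Suc k] - 1) @ tl [Suc k] \<in> set (addrs (under_forest F\<^sub>1 F\<^sub>2))"
          unfolding addrs by (force simp del: list.sel)
        with k(2) show ?thesis by simp
      qed
    qed
  qed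
  with j F leaningI show ?thesis by blast
qed

text \<open>The first forest keeps its addresses, and an edge of the second one with a nonroot
  parent moves rigidly with its subterm. Only the former root children of the second forest depend
  on \<open>f\<close>.\<close>

lemma joins_code:
  assumes j: "joins f F\<^sub>1 F\<^sub>2 G" and F: "leaning S ar F\<^sub>1" "leaning S ar F\<^sub>2" and G: "leaning S ar G"
    and dc: "dc F\<^sub>1 = Inr (length w\<^sub>1) # w\<^sub>1" "dc F\<^sub>2 = Inr (length w\<^sub>2) # w\<^sub>2"
  shows "0 < i \<Longrightarrow> i \<le> length w\<^sub>1 \<Longrightarrow> code G i = code F\<^sub>1 i"
    and "0 < i \<Longrightarrow> i \<le> length w\<^sub>2 \<Longrightarrow> code F\<^sub>2 i = (p, l) \<Longrightarrow> 0 < p \<Longrightarrow>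
      code G (length w\<^sub>1 + i) = (length w\<^sub>1 + p, l)"
    and "0 < i \<Longrightarrow> i \<le> length w\<^sub>2 \<Longrightarrow> code F\<^sub>2 i = (0, 0) \<Longrightarrow>
      \<exists>k. addrs F\<^sub>2 ! i = [k] \<and> addrs G ! (length w\<^sub>1 + i) = f k"
    and "0 < i \<Longrightarrow> i \<le> length w\<^sub>2 \<Longrightarrow> addrs F\<^sub>2 ! i = [k] \<Longrightarrow> addrs G ! (length w\<^sub>1 + i) = f k"
proof -
  note addrs = joins_addrs(1)[OF j F dc]
  have wf: "is_term UNIV (ext_arity ar) F\<^sub>1" "is_term UNIV (ext_arity ar) F\<^sub>2"
    "is_term UNIV (ext_arity ar) G" using F G leaning_iff by blast+
  have deg: "deg F\<^sub>1 = Suc (length w\<^sub>1)" "deg F\<^sub>2 = Suc (length w\<^sub>2)"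
    "deg G = Suc (length w\<^sub>1 + length w\<^sub>2)"
    using arg_cong[OF dc(1), of length] arg_cong[OF dc(2), of length]
      arg_cong[OF joins_addrs(2)[OF j F dc], of length] by simp_all
  have 1: "addrs G ! i = addrs F\<^sub>1 ! i" if "i \<le> length w\<^sub>1" for i
    unfolding addrs using that deg by (simp add: nth_append)
  have 2: "addrs G ! (length w\<^sub>1 + i) = f (hd (addrs F\<^sub>2 ! i)) @ tl (addrs F\<^sub>2 ! i)"
    if "0 < i" "i \<le> length w\<^sub>2" for i
    unfolding addrs using that deg by (cases i) (auto simp: nth_append nth_tl)
  {
    assume i: "0 < i" "i \<le> length w\<^sub>1"
    then have i': "i < deg F\<^sub>1" using deg by simp
    from obtain_edge[OF wf(1) i(1) i'] obtain p l
      where e: "edge F\<^sub>1 i = (p, l)" "p < i" "addrs F\<^sub>1 ! i = addrs F\<^sub>1 ! p @ [l]" by metis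
    then have "edge G i = (p, l)"
      using edge_eq_iff[OF wf(3) i(1), of p l] i deg 1[of i] 1[of p] by simp
    with e show "code G i = code F\<^sub>1 i" by (simp add: code_def)
  }
  {
    assume i: "0 < i" "i \<le> length w\<^sub>2" and c: "code F\<^sub>2 i = (p, l)" "0 < p"
    then have i': "i < deg F\<^sub>2" and e: "edge F\<^sub>2 i = (p, l)" using deg code_eq_edge[of F\<^sub>2 i] by auto
    from obtain_edge[OF wf(2) i(1) i'] e
    have p: "p < i" "addrs F\<^sub>2 ! i = addrs F\<^sub>2 ! p @ [l]" by auto
    \<comment> \<open>The parent is not the root, so it shares its first child number with the node,
      and \<open>f\<close> moves both alike.\<close>
    have "addrs F\<^sub>2 ! p \<noteq> []" using addrs_Nil_iff[of p F\<^sub>2] p i' c by simp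
    then have "addrs G ! (length w\<^sub>1 + i) = addrs G ! (length w\<^sub>1 + p) @ [l]"
      using 2[OF i] 2[of p] c p i by simp
    then have "edge G (length w\<^sub>1 + i) = (length w\<^sub>1 + p, l)"
      using edge_eq_iff[OF wf(3), of "length w\<^sub>1 + i" "length w\<^sub>1 + p" l] i deg p by simp
    with c show "code G (length w\<^sub>1 + i) = (length w\<^sub>1 + p, l)" by (simp add: code_def)
  }
  show 4: "addrs G ! (length w\<^sub>1 + i) = f k" if "0 < i" "i \<le> length w\<^sub>2" "addrs F\<^sub>2 ! i = [k]" for i k
    using 2[OF that(1,2)] that(3) by simp
  {
    assume i: "0 < i" "i \<le> length w\<^sub>2" and c: "code F\<^sub>2 i = (0, 0)"
    then have i': "i < deg F\<^sub>2" and "fst (edge F\<^sub>2 i) = 0" using deg code_eq_0_iff[of F\<^sub>2 i] by auto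
    then obtain k where "edge F\<^sub>2 i = (0, k)" by (metis prod.collapse)
    then have "addrs F\<^sub>2 ! i = [k]" using edge_eq_iff[OF wf(2) i(1) i', of 0 k] i' by simp
    with 4[OF i] show "\<exists>k. addrs F\<^sub>2 ! i = [k] \<and> addrs G ! (length w\<^sub>1 + i) = f k" by blast
  }
qed

lemma code_over:
  assumes F: "leaning S ar F\<^sub>1" "leaning S ar F\<^sub>2"
    and dc: "dc F\<^sub>1 = Inr (length w\<^sub>1) # w\<^sub>1" "dc F\<^sub>2 = Inr (length w\<^sub>2) # w\<^sub>2"
    and i: "0 < i" "i \<le> length w\<^sub>2" "code F\<^sub>2 i = (0, 0)"
  shows "code (over_forest F\<^sub>1 F\<^sub>2) (length w\<^sub>1 + i) = (0, 0)"
proof -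
  let ?G = "over_forest F\<^sub>1 F\<^sub>2"
  obtain k where j: "joins (\<lambda>j. [j + k]) F\<^sub>1 F\<^sub>2 ?G" using joins_over[OF F] .
  note G = leaning_over[OF F]
  have "is_term UNIV (ext_arity ar) ?G" using G leaning_iff by blast
  moreover have "deg ?G = Suc (length w\<^sub>1 + length w\<^sub>2)"
    using arg_cong[OF joins_addrs(2)[OF j F dc], of length] by simp
  moreover obtain m where "addrs ?G ! (length w\<^sub>1 + i) = [m]"
    using joins_code(3)[OF j F G dc i] by blast
  ultimately have "edge ?G (length w\<^sub>1 + i) = (0, m)"
    using edge_eq_iff[of UNIV "ext_arity ar" ?G "length w\<^sub>1 + i" 0 m] i by simp
  then show ?thesis by (simp add: code_def)
qed

text \<open>The second part is the greedy property. Extreme leaves are used in preorder, that is, by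
  decreasing edges, so a former root child lands at least as high as any extreme position
  \<open>(p, l)\<close> not taken by its predecessors. Root positions have the bottom code, hence
  \<open>0 < p\<close>.\<close>

lemma code_under:
  assumes F: "leaning S ar F\<^sub>1" "leaning S ar F\<^sub>2"
    and dc: "dc F\<^sub>1 = Inr (length w\<^sub>1) # w\<^sub>1" "dc F\<^sub>2 = Inr (length w\<^sub>2) # w\<^sub>2"
    and i: "0 < i" "i \<le> length w\<^sub>2" "code F\<^sub>2 i = (0, 0)"
  defines "G \<equiv> under_forest F\<^sub>1 F\<^sub>2"
  shows "fst (code G (length w\<^sub>1 + i)) \<le> length w\<^sub>1"
    and "0 < p \<Longrightarrow> p \<le> length w\<^sub>1 \<Longrightarrow> 1 \<le> l \<Longrightarrow> l \<le> ext_arity ar (dc F\<^sub>1 ! p) \<Longrightarrow>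
      (\<And>j. p < j \<Longrightarrow> j \<le> length w\<^sub>1 \<Longrightarrow> edge_less (p, l) (code F\<^sub>1 j)) \<Longrightarrow>
      (\<And>i'. 0 < i' \<Longrightarrow> i' < i \<Longrightarrow> code F\<^sub>2 i' = (0, 0) \<Longrightarrow>
        edge_less (p, l) (code G (length w\<^sub>1 + i'))) \<Longrightarrow>
      edge_le (p, l) (code G (length w\<^sub>1 + i))"
proof -
  let ?F = "conc F\<^sub>1 (corolla (root_arity F\<^sub>2)) :: 'a forest"
  define ps where "ps = extreme_leaves ?F"
  note F' = conc_corolla_props[OF F(1), of "root_arity F\<^sub>2"]
  note j = joins_under(1)[OF F, folded ps_def G_def]
  note G = leaning_under[OF F, folded G_def]
  note addrs = joins_addrs(1)[OF j F dc]
  have wf: "is_term UNIV (ext_arity ar) F\<^sub>1" "is_term UNIV (ext_arity ar) F\<^sub>2"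
    "is_term UNIV (ext_arity ar) G" and stacked: "stacked F\<^sub>2"
    using F G leaning_iff by blast+
  have deg: "deg F\<^sub>1 = Suc (length w\<^sub>1)" "deg F\<^sub>2 = Suc (length w\<^sub>2)"
    "deg G = Suc (length w\<^sub>1 + length w\<^sub>2)"
    using arg_cong[OF dc(1), of length] arg_cong[OF dc(2), of length]
      arg_cong[OF joins_addrs(2)[OF j F dc], of length] by simp_all
  have 1: "addrs G ! i = addrs F\<^sub>1 ! i" if "i \<le> length w\<^sub>1" for i
    unfolding addrs using that deg by (simp add: nth_append)
  obtain k where k: "addrs F\<^sub>2 ! i = [k]" "addrs G ! (length w\<^sub>1 + i) = ps ! (k - 1)"
    using joins_code(3)[OF j F G dc i] by blast
  have k_in: "[k] \<in> set (addrs F\<^sub>2)" using k(1) i deg by (metis le_imp_less_Suc length_addrs nth_mem)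
  note child = under_root_child[OF F k_in, folded ps_def]
  from child(3) obtain x m where x: "x < deg F\<^sub>1" "ps ! (k - 1) = addrs F\<^sub>1 ! x @ [m]" by blast
  then have e: "edge G (length w\<^sub>1 + i) = (x, m)"
    using edge_eq_iff[OF wf(3), of "length w\<^sub>1 + i" x m] 1[of x] deg i k by simp
  show "fst (code G (length w\<^sub>1 + i)) \<le> length w\<^sub>1"
    using e x deg by (simp add: code_def)
  assume p: "0 < p" "p \<le> length w\<^sub>1" "1 \<le> l" "l \<le> ext_arity ar (dc F\<^sub>1 ! p)"
    and less1: "\<And>j. p < j \<Longrightarrow> j \<le> length w\<^sub>1 \<Longrightarrow> edge_less (p, l) (code F\<^sub>1 j)"
    and less2: "\<And>i'. 0 < i' \<Longrightarrow> i' < i \<Longrightarrow> code F\<^sub>2 i' = (0, 0) \<Longrightarrow>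
        edge_less (p, l) (code G (length w\<^sub>1 + i'))"
  let ?P = "addrs F\<^sub>1 ! p @ [l]"
  have "edge_less (p, l) (edge F\<^sub>1 j)" if "p < j" "j < deg F\<^sub>1" for j
    using less1[of j] that deg p by (auto simp: code_def edge_less_def split: if_splits)
  then have less: "q < ?P" if "q \<in> set (addrs F\<^sub>1)" for q
    using addrs_less_if_edge_less[OF wf(1), of p l] that p deg
    by (metis in_set_conv_nth le_imp_less_Suc length_addrs)
  \<comment> \<open>Padding alters the decoration of the root only, and \<open>p\<close> is another
    node.\<close>
  have "dc ?F ! p = dc F\<^sub>1 ! p"
    using p F'(2) deg by (cases p) (auto simp: dc_def nth_tl)
  moreover have "deg ?F = deg F\<^sub>1" using F'(3) by (metis length_addrs)
  ultimately have "?P \<in> set ps"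
    using extreme_leafI[OF F'(1), of p l] p deg less unfolding F'(3) ps_def by simp
  then obtain n where n: "n < length ps" "ps ! n = ?P" by (metis in_set_conv_nth)
  \<comment> \<open>An earlier extreme leaf was given to an earlier root child \<open>i'\<close> of
    \<open>F\<^sub>2\<close>, whose code would then be \<open>(p, l)\<close>, contrary to its being
    strictly above.\<close>
  have "\<not> n < k - 1"
  proof
    assume "n < k - 1"
    moreover have "[Suc (k - 1)] \<in> set (addrs F\<^sub>2)" using k_in child(1) by simp
    ultimately have "[Suc n] \<in> set (addrs F\<^sub>2)" using stacked_mono[OF stacked, of "k - 1" n] by fastforce
    then obtain i' where i': "i' < deg F\<^sub>2" "addrs F\<^sub>2 ! i' = [Suc n]"
      by (metis in_set_conv_nth length_addrs)
    have "0 < i'" using i' by (cases i') auto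
    have "i' < i" using addrs_less_iff[of i' F\<^sub>2 i] i' i deg k(1) \<open>n < k - 1\<close> by auto
    have "edge F\<^sub>2 i' = (0, Suc n)" using edge_eq_iff[OF wf(2) \<open>0 < i'\<close> i'(1)] i' deg by simp
    then have "code F\<^sub>2 i' = (0, 0)" by (simp add: code_def)
    have "addrs G ! (length w\<^sub>1 + i') = ps ! n"
      using joins_code(4)[OF j F G dc \<open>0 < i'\<close> _ i'(2)] i'(1) deg by simp
    then have "edge G (length w\<^sub>1 + i') = (p, l)"
      using edge_eq_iff[OF wf(3), of "length w\<^sub>1 + i'" p l] 1[of p] p n i' \<open>0 < i'\<close> deg by simp
    then have "code G (length w\<^sub>1 + i') = (p, l)" using p by (simp add: code_def)
    with less2[OF \<open>0 < i'\<close> \<open>i' < i\<close> \<open>code F\<^sub>2 i' = (0, 0)\<close>] show False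
      by (simp add: edge_less_def)
  qed
  then consider "n = k - 1" | "k - 1 < n" by linarith
  then have "edge_le (p, l) (edge G (length w\<^sub>1 + i))"
  proof cases
    case 1
    then have "addrs F\<^sub>1 ! x = addrs F\<^sub>1 ! p" "m = l" using n x by auto
    then show ?thesis using e addrs_eq_iff[of x F\<^sub>1 p] x p deg by simp
  next
    case 2
    \<comment> \<open>Node \<open>i\<close> landed on an earlier leaf, which has the larger
      edge.\<close>
    then have "ps ! (k - 1) < ?P"
      using sorted_wrt_nth_less[OF sorted_extreme_leaves, of "k - 1" n ?F] n unfolding ps_def by simp
    then have "edge_less (p, l) (edge G (length w\<^sub>1 + i))"
      using edge_less_edge[OF wf(3), of p "length w\<^sub>1 + i" l] p i deg k 1[of p] by simp
    then show ?thesis by (auto simp: edge_less_def edge_le_def)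
  qed
  then show "edge_le (p, l) (code G (length w\<^sub>1 + i))"
    using p by (auto simp: code_def edge_le_def)
qed

section \<open>The over and under products as adjoints\<close>

text \<open>The order only relates forests with the same word, so it splits into these sets, which
  are finite by \<open>finite_leanings\<close>.\<close>

definition leanings :: "'s set \<Rightarrow> ('s \<Rightarrow> nat) \<Rightarrow> ('s + nat) list \<Rightarrow> 's forest set" where
  "leanings S ar w = {F. leaning S ar F \<and> dc F = Inr (length w) # w}"

lemma leanings_deg: "F \<in> leanings S ar w \<Longrightarrow> deg F = Suc (length w)"
  unfolding leanings_def by (metis (mono_tags, lifting) length_Cons length_dc mem_Collect_eq)

lemma obtain_leanings:
  assumes "leaning S ar F" obtains w where "F \<in> leanings S ar w" "set w \<subseteq> Inl ` S"
  using assms that unfolding leanings_def leaning_iff by blast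

lemma leanings_word: "F \<in> leanings S ar w \<Longrightarrow> set w \<subseteq> Inl ` S"
  unfolding leanings_def leaning_iff by auto

lemma leaning_order_iff:
  assumes "F \<in> leanings S ar w" "G \<in> leanings S ar w"
  shows "(F, G) \<in> leaning_order S ar \<longleftrightarrow>
    (\<forall>i. 0 < i \<and> i \<le> length w \<longrightarrow> edge_le (code F i) (code G i))"
proof -
  have *: "is_term UNIV (ext_arity ar) F" "is_term UNIV (ext_arity ar) G" "stacked F" "stacked G"
    "leaning S ar F" "leaning S ar G" "dc F = dc G"
    using assms by (auto simp: leanings_def leaning_iff)
  show ?thesis
    using * leanings_deg[OF assms(1)] tm_le_iff_code[OF *(1-4)]
    by (auto simp: leaning_order_def less_Suc_eq_le)
qed

lemma leaning_order_leanings: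
  assumes "(F, G) \<in> leaning_order S ar"
  shows "F \<in> leanings S ar w \<longleftrightarrow> G \<in> leanings S ar w"
  using assms by (auto simp: leaning_order_def leanings_def tm_le_def)

lemma valid_code_leanings:
  assumes "F \<in> leanings S ar w"
  shows "valid_code (\<lambda>p. ext_arity ar ((Inr (length w) # w) ! p)) (length w) (code F)"
proof -
  have "is_term UNIV (ext_arity ar) F" "dc F = Inr (length w) # w"
    using assms by (auto simp: leanings_def leaning_iff)
  with valid_code_code[of UNIV "ext_arity ar" F] leanings_deg[OF assms] show ?thesis by simp
qed

text \<open>Codes determine the forest and lie in a finite box: parents are at most the length of
  the word and positions at most the largest arity.\<close>

lemma finite_leanings: "finite (leanings S ar w)"
proof -
  let ?n = "length w"
  let ?a = "\<lambda>p. ext_arity ar ((Inr (length w) # w) ! p)"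
  let ?A = "{0..?n} \<times> {0..Max (?a ` {0..?n})}"
  define g where "g = (\<lambda>F :: 'a forest. map (code F) [1..<Suc ?n])"
  have "g ` leanings S ar w \<subseteq> {xs. set xs \<subseteq> ?A \<and> length xs = ?n}"
  proof
    fix xs assume "xs \<in> g ` leanings S ar w"
    then obtain F where F: "F \<in> leanings S ar w" "xs = g F" by blast
    have "code F i \<in> ?A" if i: "0 < i" "i \<le> ?n" for i
    proof -
      from valid_code_leanings[OF F(1)] i consider "code F i = (0, 0)"
        | "fst (code F i) < i" "snd (code F i) \<le> ?a (fst (code F i))"
        unfolding valid_code_def by blast
      then show ?thesis
      proof cases
        case 2
        then have "?a (fst (code F i)) \<le> Max (?a ` {0..?n})" using i by (intro Max_ge) auto
        from le_trans[OF 2(2) this] 2(1) i show ?thesis by (simp add: mem_Times_iff)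
      qed simp
    qed
    then have "code F ` {1..<Suc ?n} \<subseteq> ?A" by (intro image_subsetI) simp
    then show "xs \<in> {xs. set xs \<subseteq> ?A \<and> length xs = ?n}"
      unfolding F(2) g_def by (simp del: upt_Suc)
  qed
  moreover have "finite {xs. set xs \<subseteq> ?A \<and> length xs = ?n}"
    by (intro finite_lists_length_eq) simp
  ultimately have "finite (g ` leanings S ar w)" by (rule finite_subset)
  moreover have "inj_on g (leanings S ar w)"
  proof (rule inj_onI)
    fix F G assume FG: "F \<in> leanings S ar w" "G \<in> leanings S ar w" "g F = g G"
    then have "code F i = code G i" if "0 < i" "i < deg F" for i
      using that leanings_deg[OF FG(1)] by (auto simp: g_def simp del: upt_Suc)
    moreover have "is_term UNIV (ext_arity ar) F" "is_term UNIV (ext_arity ar) G" "stacked F"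
      "stacked G" "dc F = dc G" using FG by (auto simp: leanings_def leaning_iff)
    ultimately show "F = G" using code_inj by blast
  qed
  ultimately show ?thesis by (rule finite_imageD)
qed

text \<open>This is the guard in the recursion of \<open>moebius\<close>, which is constantly 0 on
  other relations.\<close>

lemma locally_finite_leaning_order: "locally_finite_order (leaning_order S ar)"
proof -
  let ?r = "leaning_order S ar"
  have refl: "(F, F) \<in> ?r" if "leaning S ar F" for F
    using that by (simp add: leaning_order_def tm_le_def)
  have "refl_on (Field ?r) ?r"
    using refl by (auto simp: refl_on_def Field_def leaning_order_def)
  moreover have "trans ?r"
  proof (rule transI)
    fix F G H assume "(F, G) \<in> ?r" "(G, H) \<in> ?r"
    moreover then have "deg F = deg G" unfolding leaning_order_def tm_le_def deg_def by auto
    ultimately show "(F, H) \<in> ?r"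
      unfolding leaning_order_def tm_le_def by (auto intro: order_trans)
  qed
  moreover have "antisym ?r"
    by (rule antisymI) (auto simp: leaning_order_def leaning_iff intro: tm_le_antisym)
  moreover have "finite (interval ?r F G)" for F G
  proof (cases "leaning S ar F")
    case True
    then obtain w where "F \<in> leanings S ar w" using obtain_leanings by blast
    then have "interval ?r F G \<subseteq> leanings S ar w"
      unfolding interval_def using leaning_order_leanings by blast
    then show ?thesis using finite_leanings finite_subset by blast
  next
    case False
    then have "interval ?r F G = {}" by (auto simp: interval_def leaning_order_def)
    then show ?thesis by simp
  qed
  moreover have "Field ?r \<times> Field ?r \<supseteq> ?r" by (auto simp: Field_def)
  ultimately show ?thesis
    by (simp add: locally_finite_order_def partial_order_on_def preorder_on_def)
qed

lemma all_split:
  "(\<forall>i. 0 < i \<and> i \<le> m + n \<longrightarrow> P i) \<longleftrightarrow>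
     (\<forall>i. 0 < i \<and> i \<le> m \<longrightarrow> P i) \<and> (\<forall>i. 0 < i \<and> i \<le> n \<longrightarrow> P (m + i :: nat))"
proof safe
  fix i assume *: "\<forall>i. 0 < i \<and> i \<le> m \<longrightarrow> P i" "\<forall>i. 0 < i \<and> i \<le> n \<longrightarrow> P (m + i)"
    and i: "0 < i" "i \<le> m + n"
  show "P i"
  proof (cases "i \<le> m")
    case False
    with *(2) i have "P (m + (i - m))" by (intro *(2)[rule_format]) auto
    with False show ?thesis by simp
  qed (use * i in auto)
qed auto

text \<open>The pair \<open>q\<^sub>1\<close>, \<open>q\<^sub>2\<close> is the cut of
  \<open>q\<close>. Its existence rests on \<open>obtain_leaning\<close>, and both adjunctions are
  checked node by node on codes.\<close>

lemma leaning_adjunction: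
  assumes q: "q \<in> leanings S ar (w\<^sub>1 @ w\<^sub>2)"
  obtains q\<^sub>1 q\<^sub>2 where "q\<^sub>1 \<in> leanings S ar w\<^sub>1" "q\<^sub>2 \<in> leanings S ar w\<^sub>2"
    "\<And>F\<^sub>1 F\<^sub>2. F\<^sub>1 \<in> leanings S ar w\<^sub>1 \<Longrightarrow> F\<^sub>2 \<in> leanings S ar w\<^sub>2 \<Longrightarrow>
      (over_forest F\<^sub>1 F\<^sub>2, q) \<in> leaning_order S ar \<longleftrightarrow>
      (F\<^sub>1, q\<^sub>1) \<in> leaning_order S ar \<and> (F\<^sub>2, q\<^sub>2) \<in> leaning_order S ar"
    "\<And>F\<^sub>1 F\<^sub>2. F\<^sub>1 \<in> leanings S ar w\<^sub>1 \<Longrightarrow> F\<^sub>2 \<in> leanings S ar w\<^sub>2 \<Longrightarrow>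
      (q, under_forest F\<^sub>1 F\<^sub>2) \<in> leaning_order S ar \<longleftrightarrow>
      (q\<^sub>1, F\<^sub>1) \<in> leaning_order S ar \<and> (q\<^sub>2, F\<^sub>2) \<in> leaning_order S ar"
proof -
  let ?m = "length w\<^sub>1" and ?n = "length w\<^sub>2"
  let ?a = "\<lambda>w p. ext_arity ar ((Inr (length w) # w :: ('a + nat) list) ! p)"
  define c where "c = code q"
  \<comment> \<open>Edges into the first part become the bottom code; the others are
    renumbered.\<close>
  define c\<^sub>2 where "c\<^sub>2 = (\<lambda>i. if fst (c (?m + i)) \<le> ?m then (0, 0)
    else (fst (c (?m + i)) - ?m, snd (c (?m + i))))"
  have valid: "c i = (0, 0) \<or> (0 < fst (c i) \<and> fst (c i) < i \<and> 1 \<le> snd (c i) \<and>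
      snd (c i) \<le> ?a (w\<^sub>1 @ w\<^sub>2) (fst (c i)) \<and> (\<forall>j. fst (c i) < j \<and> j < i \<longrightarrow> edge_less (c i) (c j)))"
    if "0 < i" "i \<le> ?m + ?n" for i
    using valid_code_leanings[OF q] that unfolding valid_code_def c_def by simp
  \<comment> \<open>Only the root arity depends on the length of the word; cutting preserves the
    arities of all other nodes.\<close>
  have a1: "?a (w\<^sub>1 @ w\<^sub>2) p = ?a w\<^sub>1 p" if "0 < p" "p \<le> ?m" for p
    using that by (cases p) (auto simp: nth_append)
  have a2: "?a (w\<^sub>1 @ w\<^sub>2) p = ?a w\<^sub>2 (p - ?m)" if "?m < p" for p
    using that by (cases p) (auto simp: nth_append Suc_diff_le)
  have words: "set w\<^sub>1 \<subseteq> Inl ` S" "set w\<^sub>2 \<subseteq> Inl ` S" using leanings_word[OF q] by auto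
  have "valid_code (?a w\<^sub>1) ?m c"
    unfolding valid_code_def
  proof (intro allI impI)
    fix i assume i: "0 < i \<and> i \<le> ?m"
    with valid[of i] a1[of "fst (c i)"]
    show "c i = (0, 0) \<or> (0 < fst (c i) \<and> fst (c i) < i \<and> 1 \<le> snd (c i) \<and>
      snd (c i) \<le> ?a w\<^sub>1 (fst (c i)) \<and> (\<forall>j. fst (c i) < j \<and> j < i \<longrightarrow> edge_less (c i) (c j)))"
      by auto
  qed
  from obtain_leaning[OF words(1) this] obtain q\<^sub>1 where q1: "q\<^sub>1 \<in> leanings S ar w\<^sub>1"
    "\<And>i. 0 < i \<Longrightarrow> i \<le> ?m \<Longrightarrow> code q\<^sub>1 i = c i" unfolding leanings_def by blast
  have "valid_code (?a w\<^sub>2) ?n c\<^sub>2"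
    unfolding valid_code_def
  proof (intro allI impI)
    fix i assume i: "0 < i \<and> i \<le> ?n"
    show "c\<^sub>2 i = (0, 0) \<or> (0 < fst (c\<^sub>2 i) \<and> fst (c\<^sub>2 i) < i \<and> 1 \<le> snd (c\<^sub>2 i) \<and>
      snd (c\<^sub>2 i) \<le> ?a w\<^sub>2 (fst (c\<^sub>2 i)) \<and> (\<forall>j. fst (c\<^sub>2 i) < j \<and> j < i \<longrightarrow> edge_less (c\<^sub>2 i) (c\<^sub>2 j)))"
    proof (cases "fst (c (?m + i)) \<le> ?m")
      case False
      then obtain x l where xl: "c (?m + i) = (x, l)" "?m < x" by (cases "c (?m + i)") auto
      then have c2: "c\<^sub>2 i = (x - ?m, l)" by (simp add: c\<^sub>2_def)
      have v: "x < ?m + i" "1 \<le> l" "l \<le> ?a (w\<^sub>1 @ w\<^sub>2) x"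
        "\<And>j. x < j \<Longrightarrow> j < ?m + i \<Longrightarrow> edge_less (x, l) (c j)"
        using valid[of "?m + i"] i xl by auto
      \<comment> \<open>The edges in between exceed \<open>(x, l)\<close>, so their parents lie in
        the second part as well: they are shifted, not cut.\<close>
      have "edge_less (x - ?m, l) (c\<^sub>2 j)" if j: "x - ?m < j" "j < i" for j
      proof -
        have "x < ?m + j" using j xl(2) by linarith
        then have "edge_less (x, l) (c (?m + j))" using v(4) j(2) by simp
        with xl(2) show ?thesis by (auto simp: edge_less_def c\<^sub>2_def)
      qed
      then show ?thesis using c2 xl(2) v(1-3) a2[OF xl(2)] by auto
    qed (simp add: c\<^sub>2_def)
  qed
  from obtain_leaning[OF words(2) this] obtain q\<^sub>2 where q2: "q\<^sub>2 \<in> leanings S ar w\<^sub>2"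
    "\<And>i. 0 < i \<Longrightarrow> i \<le> ?n \<Longrightarrow> code q\<^sub>2 i = c\<^sub>2 i" unfolding leanings_def by blast
  show ?thesis
  proof (rule that[OF q1(1) q2(1)])
    fix F\<^sub>1 F\<^sub>2 assume F: "F\<^sub>1 \<in> leanings S ar w\<^sub>1" "F\<^sub>2 \<in> leanings S ar w\<^sub>2"
    then have F': "leaning S ar F\<^sub>1" "leaning S ar F\<^sub>2" "dc F\<^sub>1 = Inr ?m # w\<^sub>1" "dc F\<^sub>2 = Inr ?n # w\<^sub>2"
      by (auto simp: leanings_def)
    let ?O = "over_forest F\<^sub>1 F\<^sub>2" and ?U = "under_forest F\<^sub>1 F\<^sub>2"
    obtain k where jO: "joins (\<lambda>j. [j + k]) F\<^sub>1 F\<^sub>2 ?O" using joins_over[OF F'(1,2)] .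
    note jU = joins_under(1)[OF F'(1,2)]
    note lO = leaning_over[OF F'(1,2)] and lU = leaning_under[OF F'(1,2)]
    have O: "?O \<in> leanings S ar (w\<^sub>1 @ w\<^sub>2)" and U: "?U \<in> leanings S ar (w\<^sub>1 @ w\<^sub>2)"
      using lO lU joins_addrs(2)[OF jO F'] joins_addrs(2)[OF jU F'] by (simp_all add: leanings_def)
    note cO = joins_code[OF jO F'(1,2) lO F'(3,4)] and cU = joins_code[OF jU F'(1,2) lU F'(3,4)]
    note zero = code_over[OF F'] and greedy = code_under[OF F']
    \<comment> \<open>Where \<open>F\<^sub>2\<close> has the bottom code, so has the over product,
      and both sides hold; elsewhere both codes are shifted by the length of the first word.\<close>
    have "edge_le (code ?O (?m + i)) (c (?m + i)) \<longleftrightarrow> edge_le (code F\<^sub>2 i) (c\<^sub>2 i)"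
      if i: "0 < i" "i \<le> ?n" for i
    proof (cases "code F\<^sub>2 i = (0, 0)")
      case True
      have "edge_le (0, 0) (c (?m + i))" "edge_le (0, 0) (c\<^sub>2 i)"
        using code_eq_0[of q "?m + i"] by (auto simp: c_def c\<^sub>2_def edge_le_def)
      with zero[OF i True] True show ?thesis by simp
    next
      case False
      then obtain p l where pl: "code F\<^sub>2 i = (p, l)" "0 < p"
        using code_eq_0[of F\<^sub>2 i] by (cases "code F\<^sub>2 i") auto
      with cO(2)[OF i pl] show ?thesis by (auto simp: edge_le_def c\<^sub>2_def)
    qed
    then show "(?O, q) \<in> leaning_order S ar \<longleftrightarrow>
        (F\<^sub>1, q\<^sub>1) \<in> leaning_order S ar \<and> (F\<^sub>2, q\<^sub>2) \<in> leaning_order S ar"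
      unfolding leaning_order_iff[OF O q] leaning_order_iff[OF F(1) q1(1)]
        leaning_order_iff[OF F(2) q2(1)] length_append all_split
      using q1(2) q2(2) cO(1) by (auto simp: c_def)
    \<comment> \<open>The comparison on the first part is assumed because it decides which positions
      of \<open>F\<^sub>1\<close> are still open.\<close>
    have "(\<forall>i. 0 < i \<and> i \<le> ?n \<longrightarrow> edge_le (c (?m + i)) (code ?U (?m + i))) \<longleftrightarrow>
        (\<forall>i. 0 < i \<and> i \<le> ?n \<longrightarrow> edge_le (c\<^sub>2 i) (code F\<^sub>2 i))"
      if le1: "\<forall>i. 0 < i \<and> i \<le> ?m \<longrightarrow> edge_le (c i) (code F\<^sub>1 i)"
    proof (intro iffI allI impI)
      fix i assume *: "\<forall>i. 0 < i \<and> i \<le> ?n \<longrightarrow> edge_le (c (?m + i)) (code ?U (?m + i))"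
        and i: "0 < i \<and> i \<le> ?n"
      then have le: "edge_le (c (?m + i)) (code ?U (?m + i))" by blast
      show "edge_le (c\<^sub>2 i) (code F\<^sub>2 i)"
      proof (cases "code F\<^sub>2 i = (0, 0)")
        case True
        then have "fst (code ?U (?m + i)) \<le> ?m" using greedy(1) i by blast
        with le have "fst (c (?m + i)) \<le> ?m" by (auto simp: edge_le_def)
        with True show ?thesis by (simp add: c\<^sub>2_def)
      next
        case False
        then obtain p l where pl: "code F\<^sub>2 i = (p, l)" "0 < p"
          using code_eq_0[of F\<^sub>2 i] by (cases "code F\<^sub>2 i") auto
        with cU(2)[of i p l] i le show ?thesis by (auto simp: edge_le_def c\<^sub>2_def)
      qed
    next
      fix i assume *: "\<forall>i. 0 < i \<and> i \<le> ?n \<longrightarrow> edge_le (c\<^sub>2 i) (code F\<^sub>2 i)"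
        and "0 < i \<and> i \<le> ?n"
      \<comment> \<open>Strong induction, since the greedy choice at \<open>i\<close> depends on
        where the earlier root children of \<open>F\<^sub>2\<close> have gone.\<close>
      then show "edge_le (c (?m + i)) (code ?U (?m + i))"
      proof (induction i rule: less_induct)
        case (less i)
        then have i: "0 < i" "i \<le> ?n" and le: "edge_le (c\<^sub>2 i) (code F\<^sub>2 i)" by auto
        show ?case
        proof (cases "code F\<^sub>2 i = (0, 0)")
          case True
          with le have "fst (c\<^sub>2 i) = 0" by (auto simp: edge_le_def)
          then have small: "fst (c (?m + i)) \<le> ?m" by (auto simp: c\<^sub>2_def split: if_splits)
          show ?thesis
          proof (cases "c (?m + i) = (0, 0)")
            case True
            then show ?thesis using code_eq_0[of ?U "?m + i"] by (auto simp: edge_le_def)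
          next
            case False
            obtain x l where xl: "c (?m + i) = (x, l)" by fastforce
            have v: "0 < x" "x \<le> ?m" "1 \<le> l" "l \<le> ?a (w\<^sub>1 @ w\<^sub>2) x"
              "\<And>j. x < j \<Longrightarrow> j < ?m + i \<Longrightarrow> edge_less (x, l) (c j)"
              using valid[of "?m + i"] i xl small False by auto
            have "edge_le (x, l) (code ?U (?m + i))"
            \<comment> \<open>Validity of \<open>q\<close> puts \<open>(x, l)\<close> strictly below
              the codes of \<open>q\<close> after \<open>x\<close>; these lie below the codes of
              \<open>F\<^sub>1\<close> by assumption and below those of the earlier attached roots
              by induction. So \<open>(x, l)\<close> is extreme and not yet taken.\<close>
            proof (rule greedy(2)[OF i True v(1-3)])
              show "l \<le> ext_arity ar (dc F\<^sub>1 ! x)" using v a1[of x] F'(3) by simp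
              show "edge_less (x, l) (code F\<^sub>1 j)" if "x < j" "j \<le> ?m" for j
                using edge_less_le_trans[OF v(5)] le1 that i v(1) by simp
              show "edge_less (x, l) (code ?U (?m + i'))"
                if "0 < i'" "i' < i" "code F\<^sub>2 i' = (0, 0)" for i'
                using edge_less_le_trans[OF v(5) less.IH] less.prems that i v(2) by simp
            qed
            with xl show ?thesis by simp
          qed
        next
          case False
          then obtain p l where pl: "code F\<^sub>2 i = (p, l)" "0 < p"
            using code_eq_0[of F\<^sub>2 i] by (cases "code F\<^sub>2 i") auto
          with cU(2)[OF i pl] le show ?thesis
            by (auto simp: edge_le_def c\<^sub>2_def split: if_splits)
        qed
      qed
    qed
    then show "(q, ?U) \<in> leaning_order S ar \<longleftrightarrow>
        (q\<^sub>1, F\<^sub>1) \<in> leaning_order S ar \<and> (q\<^sub>2, F\<^sub>2) \<in> leaning_order S ar"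
      unfolding leaning_order_iff[OF q U] leaning_order_iff[OF q1(1) F(1)]
        leaning_order_iff[OF q2(1) F(2)] length_append all_split
      using q1(2) q2(2) cU(1) by (auto simp: c_def)
  qed
qed

lemma over_under_leanings:
  assumes F: "F\<^sub>1 \<in> leanings S ar w\<^sub>1" "F\<^sub>2 \<in> leanings S ar w\<^sub>2"
  shows "over_forest F\<^sub>1 F\<^sub>2 \<in> leanings S ar (w\<^sub>1 @ w\<^sub>2)"
    and "under_forest F\<^sub>1 F\<^sub>2 \<in> leanings S ar (w\<^sub>1 @ w\<^sub>2)"
proof -
  have F': "leaning S ar F\<^sub>1" "leaning S ar F\<^sub>2"
    "dc F\<^sub>1 = Inr (length w\<^sub>1) # w\<^sub>1" "dc F\<^sub>2 = Inr (length w\<^sub>2) # w\<^sub>2"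
    using F by (auto simp: leanings_def)
  obtain k where "joins (\<lambda>j. [j + k]) F\<^sub>1 F\<^sub>2 (over_forest F\<^sub>1 F\<^sub>2)" using joins_over[OF F'(1,2)] .
  from joins_addrs(2)[OF this F'] leaning_over[OF F'(1,2)]
  show "over_forest F\<^sub>1 F\<^sub>2 \<in> leanings S ar (w\<^sub>1 @ w\<^sub>2)" by (simp add: leanings_def)
  from joins_addrs(2)[OF joins_under(1)[OF F'(1,2)] F'] leaning_under[OF F'(1,2)]
  show "under_forest F\<^sub>1 F\<^sub>2 \<in> leanings S ar (w\<^sub>1 @ w\<^sub>2)" by (simp add: leanings_def)
qed

section \<open>Moebius inversion\<close>

lemma locally_finite_orderD:
  assumes "locally_finite_order r"
  shows "finite (interval r x y)"
    and "(x, y) \<in> r \<Longrightarrow> (x, x) \<in> r" and "(x, y) \<in> r \<Longrightarrow> (y, y) \<in> r"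
    and "(x, y) \<in> r \<Longrightarrow> (y, z) \<in> r \<Longrightarrow> (x, z) \<in> r"
    and "(x, y) \<in> r \<Longrightarrow> (y, x) \<in> r \<Longrightarrow> x = y"
  using assms
  by (auto simp: locally_finite_order_def partial_order_on_def preorder_on_def refl_on_def Field_def
      dest: transD antisymD)

lemma moebius_eq_0: "(x, y) \<notin> r \<Longrightarrow> moebius r x y = 0"
  by (simp add: moebius.simps)

lemma moebius_neq_0: "of_int (moebius r x y) \<noteq> (0 :: 'k::ring_1) \<Longrightarrow> (x, y) \<in> r"
  using moebius_eq_0 by fastforce

lemma sum_moebius_left:
  assumes r: "locally_finite_order r" and xy: "(x, y) \<in> r"
  shows "(\<Sum>z\<in>interval r x y. moebius r x z) = of_bool (x = y)"
proof -
  note D = locally_finite_orderD[OF r]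
  have y: "y \<in> interval r x y" using xy D(3) by (auto simp: interval_def)
  have "(\<Sum>z\<in>interval r x y. moebius r x z) =
      moebius r x y + (\<Sum>z\<in>interval r x y - {y}. moebius r x z)"
    using y D(1) by (simp add: sum.remove)
  also have "\<dots> = of_bool (x = y)"
  proof (cases "x = y")
    case True
    then have empty: "interval r x y - {y} = {}" using D(5) by (auto simp: interval_def)
    show ?thesis unfolding empty using True xy r by (simp add: moebius.simps[of r y y])
  next
    case False
    with xy r show ?thesis by (simp add: moebius.simps[of r x y])
  qed
  finally show ?thesis .
qed

text \<open>
  By the recursion the Moebius function is a left inverse of the zeta function; a left inverse in
  the incidence algebra is a right inverse because zeta can be cancelled on the right.
\<close>

lemma sum_moebius_right:
  assumes r: "locally_finite_order r" and xy: "(x, y) \<in> r"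
  shows "(\<Sum>z\<in>interval r x y. moebius r z y) = of_bool (x = y)"
proof -
  note D = locally_finite_orderD[OF r]
  \<comment> \<open>The defect of the claim as a function of the upper end; its sums over all
    intervals from \<open>x\<close> vanish, which forces it to vanish itself.\<close>
  define h where "h y = (\<Sum>z\<in>interval r x y. moebius r z y) - of_bool (x = y)" for y
  have sum_h: "(\<Sum>y\<in>interval r x t. h y) = 0" if t: "(x, t) \<in> r" for t
  proof -
    let ?I = "interval r x t"
    have fin: "finite ?I" by (rule D(1))
    have "(\<Sum>y\<in>?I. \<Sum>z\<in>interval r x y. moebius r z y) =
        (\<Sum>y\<in>?I. \<Sum>z | z \<in> ?I \<and> (z, y) \<in> r. moebius r z y)"
      using D(4) by (intro sum.cong refl) (auto simp: interval_def)
    also have "\<dots> = (\<Sum>z\<in>?I. \<Sum>y | y \<in> ?I \<and> (z, y) \<in> r. moebius r z y)"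
      by (rule sum.swap_restrict[OF fin fin])
    also have "\<dots> = (\<Sum>z\<in>?I. \<Sum>y\<in>interval r z t. moebius r z y)"
      using D(4) by (intro sum.cong refl) (auto simp: interval_def)
    also have "\<dots> = (\<Sum>z\<in>?I. of_bool (z = t))"
      by (intro sum.cong refl sum_moebius_left[OF r]) (simp add: interval_def)
    also have "\<dots> = 1" using t D(3) fin by (simp add: of_bool_def interval_def)
    also have "1 = (\<Sum>y\<in>?I. of_bool (x = y) :: int)"
      using t D(2) fin by (simp add: of_bool_def interval_def)
    finally show ?thesis by (simp add: h_def sum_subtractf)
  qed
  have "h t = 0" if "(x, t) \<in> r" for t
    using that
  proof (induction "card (interval r x t)" arbitrary: t rule: less_induct)
    case less
    have t: "t \<in> interval r x t" using less.prems D(3) by (auto simp: interval_def)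
    have "h s = 0" if s: "s \<in> interval r x t - {t}" for s
    proof (rule less.hyps)
      show "(x, s) \<in> r" using s by (simp add: interval_def)
      have "interval r x s \<subset> interval r x t"
        using s t D(4,5) unfolding interval_def by blast
      then show "card (interval r x s) < card (interval r x t)"
        using D(1) by (simp add: psubset_card_mono)
    qed
    then have "(\<Sum>s\<in>interval r x t. h s) = h t"
      using t D(1) by (simp add: sum.remove[of _ t])
    with sum_h[OF less.prems] show ?case by simp
  qed
  with xy show ?thesis by (simp add: h_def)
qed

text \<open>Restated over a fixed finite range \<open>P\<close> containing everything above
  \<open>x\<close>, so that sums can be interchanged later; the terms outside the interval are
  0.\<close>

lemma sum_moebius_zeta:
  assumes r: "locally_finite_order r" and P: "finite P" "x \<in> P" "(x, x) \<in> r"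
    and closed: "\<And>z. (x, z) \<in> r \<Longrightarrow> z \<in> P"
  shows "(\<Sum>z\<in>P. of_int (moebius r x z) * of_bool ((z, y) \<in> r)) = (of_bool (x = y) :: 'k::field)"
proof -
  have "(\<Sum>z\<in>P. of_int (moebius r x z) * of_bool ((z, y) \<in> r)) =
      (\<Sum>z\<in>interval r x y. of_int (moebius r x z) :: 'k)"
    using P(1) closed moebius_neq_0
    by (intro sum.mono_neutral_cong_right) (auto simp: interval_def)
  also have "\<dots> = of_bool (x = y)"
  proof (cases "(x, y) \<in> r")
    case True
    from arg_cong[OF sum_moebius_left[OF r True], of "of_int :: int \<Rightarrow> 'k"] show ?thesis by simp
  next
    case False
    then have "interval r x y = {}" using locally_finite_orderD(4)[OF r] by (auto simp: interval_def)
    then show ?thesis using False P(3) by auto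
  qed
  finally show ?thesis .
qed

lemma sum_zeta_moebius:
  assumes r: "locally_finite_order r" and P: "finite P" "x \<in> P" "(x, x) \<in> r"
    and closed: "\<And>z. (x, z) \<in> r \<Longrightarrow> z \<in> P"
  shows "(\<Sum>z\<in>P. of_bool ((x, z) \<in> r) * of_int (moebius r z y)) = (of_bool (x = y) :: 'k::field)"
proof -
  have "(\<Sum>z\<in>P. of_bool ((x, z) \<in> r) * of_int (moebius r z y)) =
      (\<Sum>z\<in>interval r x y. of_int (moebius r z y) :: 'k)"
    using P(1) closed moebius_neq_0
    by (intro sum.mono_neutral_cong_right) (auto simp: interval_def)
  also have "\<dots> = of_bool (x = y)"
  proof (cases "(x, y) \<in> r")
    case True
    from arg_cong[OF sum_moebius_right[OF r True], of "of_int :: int \<Rightarrow> 'k"] show ?thesis by simp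
  next
    case False
    then have "interval r x y = {}" using locally_finite_orderD(4)[OF r] by (auto simp: interval_def)
    then show ?thesis using False P(3) by auto
  qed
  finally show ?thesis .
qed

section \<open>Products of the homogeneous basis\<close>

lemma leaning_order_refl: "F \<in> leanings S ar w \<Longrightarrow> (F, F) \<in> leaning_order S ar"
  by (simp add: leanings_def leaning_order_def tm_le_def)

lemma lookup_F_basis:
  assumes "F \<in> leanings S ar w"
  shows "Poly_Mapping.lookup (F_basis S ar F :: ('s, 'k::field) vec) X =
    of_int (moebius (leaning_order S ar) F X)"
proof -
  have "{G. (F, G) \<in> leaning_order S ar} \<subseteq> leanings S ar w"
    using leaning_order_leanings assms by blast
  \<comment> \<open>Over an infinite index set the sum in \<open>F_basis\<close> would be 0 by
    default.\<close>
  then have "finite {G. (F, G) \<in> leaning_order S ar}" using finite_leanings finite_subset by blast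
  then show ?thesis
    by (auto simp: F_basis_def lookup_sum lookup_single when_def moebius_eq_0)
qed

lemma lookup_H_basis:
  assumes "F \<in> leanings S ar w"
  shows "Poly_Mapping.lookup (H_basis S ar F :: ('s, 'k::field) vec) X =
    (\<Sum>G\<in>leanings S ar w. of_bool ((G, F) \<in> leaning_order S ar) *
      of_int (moebius (leaning_order S ar) G X))"
proof -
  have sub: "{G. (G, F) \<in> leaning_order S ar} \<subseteq> leanings S ar w"
    using leaning_order_leanings assms by blast
  have "Poly_Mapping.lookup (H_basis S ar F :: ('s, 'k) vec) X =
      (\<Sum>G | (G, F) \<in> leaning_order S ar. Poly_Mapping.lookup (F_basis S ar G :: ('s, 'k) vec) X)"
    by (simp add: H_basis_def lookup_sum)
  also have "\<dots> = (\<Sum>G | (G, F) \<in> leaning_order S ar. of_int (moebius (leaning_order S ar) G X))"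
    using sub by (intro sum.cong refl lookup_F_basis[of _ S ar w]) auto
  also have "\<dots> = (\<Sum>G\<in>leanings S ar w. of_bool ((G, F) \<in> leaning_order S ar) *
      of_int (moebius (leaning_order S ar) G X))"
    using sub by (intro sum.mono_neutral_cong_left finite_leanings) auto
  finally show ?thesis .
qed

text \<open>E_X is the sum of all F_q with q above X, so the left side is the coordinate of the
  vector at F_q. In the incidence algebra zeta times Moebius times zeta is zeta.\<close>

lemma sum_lookup_H_basis:
  assumes F: "F \<in> leanings S ar w" and q: "q \<in> leanings S ar w"
  shows "(\<Sum>X\<in>leanings S ar w. Poly_Mapping.lookup (H_basis S ar F :: ('s, 'k::field) vec) X *
      of_bool ((X, q) \<in> leaning_order S ar)) = of_bool ((q, F) \<in> leaning_order S ar)"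
proof -
  let ?P = "leanings S ar w" and ?r = "leaning_order S ar"
  have "(\<Sum>X\<in>?P. Poly_Mapping.lookup (H_basis S ar F :: ('s, 'k) vec) X * of_bool ((X, q) \<in> ?r)) =
      (\<Sum>X\<in>?P. \<Sum>G\<in>?P. of_bool ((G, F) \<in> ?r) * (of_int (moebius ?r G X) * of_bool ((X, q) \<in> ?r)))"
    by (simp add: lookup_H_basis[OF F] sum_distrib_right mult.assoc)
  also have "\<dots> =
      (\<Sum>G\<in>?P. of_bool ((G, F) \<in> ?r) * (\<Sum>X\<in>?P. of_int (moebius ?r G X) * of_bool ((X, q) \<in> ?r)))"
    by (subst sum.swap) (simp add: sum_distrib_left)
  also have "\<dots> = (\<Sum>G\<in>?P. of_bool ((G, F) \<in> ?r) * of_bool (G = q))"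
  proof (intro sum.cong refl arg_cong2[of _ _ _ _ "(*)"] sum_moebius_zeta)
    show "z \<in> ?P" if "G \<in> ?P" "(G, z) \<in> ?r" for G z
      using that leaning_order_leanings by blast
  qed (auto intro: locally_finite_leaning_order finite_leanings leaning_order_refl)
  also have "\<dots> = (\<Sum>G\<in>{q}. of_bool ((q, F) \<in> ?r))"
    using q finite_leanings by (intro sum.mono_neutral_cong_right) auto
  finally show ?thesis by simp
qed

text \<open>Fixed finite ranges replace the supports, which prepares the interchange of
  sums.\<close>

lemma lookup_mult:
  assumes "finite A" "Poly_Mapping.keys x \<subseteq> A" "finite B" "Poly_Mapping.keys y \<subseteq> B"
  shows "Poly_Mapping.lookup (mult x y) Z = (\<Sum>F\<in>A. \<Sum>G\<in>B.
    of_bool (over_forest F G = Z) * (Poly_Mapping.lookup x F * Poly_Mapping.lookup y G))"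
proof -
  have "Poly_Mapping.lookup (mult x y) Z = (\<Sum>F\<in>Poly_Mapping.keys x. \<Sum>G\<in>Poly_Mapping.keys y.
      of_bool (over_forest F G = Z) * (Poly_Mapping.lookup x F * Poly_Mapping.lookup y G))"
    unfolding mult_def lookup_sum lookup_single
    by (intro sum.cong refl) (simp add: when_def)
  also have "\<dots> = (\<Sum>F\<in>Poly_Mapping.keys x. \<Sum>G\<in>B.
      of_bool (over_forest F G = Z) * (Poly_Mapping.lookup x F * Poly_Mapping.lookup y G))"
    using assms(3,4) by (intro sum.cong refl sum.mono_neutral_left) (auto simp: in_keys_iff)
  also have "\<dots> = (\<Sum>F\<in>A. \<Sum>G\<in>B.
      of_bool (over_forest F G = Z) * (Poly_Mapping.lookup x F * Poly_Mapping.lookup y G))"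
    using assms(1,2) by (intro sum.mono_neutral_left) (auto simp: in_keys_iff)
  finally show ?thesis .
qed

lemma keys_H_basis:
  assumes "F \<in> leanings S ar w"
  shows "Poly_Mapping.keys (H_basis S ar F :: ('s, 'k::field) vec) \<subseteq> leanings S ar w"
proof
  fix X assume "X \<in> Poly_Mapping.keys (H_basis S ar F :: ('s, 'k) vec)"
  then obtain G where "G \<in> leanings S ar w" "(G, X) \<in> leaning_order S ar"
    unfolding in_keys_iff lookup_H_basis[OF assms]
    by (elim sum.not_neutral_contains_not_neutral) (metis moebius_neq_0 mult_zero_right)
  then show "X \<in> leanings S ar w" using leaning_order_leanings by blast
qed

theorem theorem5p3p2:
  fixes S :: "'s set" and ar :: "'s \<Rightarrow> nat" and F\<^sub>1 F\<^sub>2 :: "'s forest"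
  assumes "leaning S ar F\<^sub>1" and "leaning S ar F\<^sub>2"
  shows "mult (H_basis S ar F\<^sub>1 :: ('s, 'k::field) vec) (H_basis S ar F\<^sub>2)
    = H_basis S ar (under_forest F\<^sub>1 F\<^sub>2)"
proof (rule poly_mapping_eqI)
  fix Y
  obtain w\<^sub>1 where F1: "F\<^sub>1 \<in> leanings S ar w\<^sub>1" using obtain_leanings[OF assms(1)] by blast
  obtain w\<^sub>2 where F2: "F\<^sub>2 \<in> leanings S ar w\<^sub>2" using obtain_leanings[OF assms(2)] by blast
  define P where "P = leanings S ar w\<^sub>1"
  define Q where "Q = leanings S ar w\<^sub>2"
  define R where "R = leanings S ar (w\<^sub>1 @ w\<^sub>2)"
  define le where "le F G \<longleftrightarrow> (F, G) \<in> leaning_order S ar" for F G :: "'s forest"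
  define \<mu> where "\<mu> F G = (of_int (moebius (leaning_order S ar) F G) :: 'k)" for F G
  define h where "h = Poly_Mapping.lookup (H_basis S ar F\<^sub>1 :: ('s, 'k) vec)"
  define k where "k = Poly_Mapping.lookup (H_basis S ar F\<^sub>2 :: ('s, 'k) vec)"
  have fin: "finite P" "finite Q" by (simp_all add: P_def Q_def finite_leanings)
  have over: "over_forest F G \<in> R" if "F \<in> P" "G \<in> Q" for F G
    using over_under_leanings(1) that unfolding P_def Q_def R_def by blast
  \<comment> \<open>The expansion of E_X into fundamental vectors, read at the coefficient of
    E_Y.\<close>
  have expand: "of_bool (X = Y) = (\<Sum>q\<in>R. of_bool (le X q) * \<mu> q Y)" if X: "X \<in> R" for X
    unfolding le_def \<mu>_def R_def
  proof (intro sum_zeta_moebius[symmetric] locally_finite_leaning_order finite_leanings)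
    show "X \<in> leanings S ar (w\<^sub>1 @ w\<^sub>2)" "(X, X) \<in> leaning_order S ar"
      using X leaning_order_refl unfolding R_def by blast+
    show "q \<in> leanings S ar (w\<^sub>1 @ w\<^sub>2)" if "(X, q) \<in> leaning_order S ar" for q
      using X leaning_order_leanings[OF that] unfolding R_def by blast
  qed
  \<comment> \<open>Both adjunctions in one predicate, so that one choice yields projections serving
    both.\<close>
  define adj where "adj q q\<^sub>1 q\<^sub>2 \<longleftrightarrow> q\<^sub>1 \<in> P \<and> q\<^sub>2 \<in> Q \<and> (\<forall>F\<in>P. \<forall>G\<in>Q.
      (le (over_forest F G) q \<longleftrightarrow> le F q\<^sub>1 \<and> le G q\<^sub>2) \<and>
      (le q (under_forest F G) \<longleftrightarrow> le q\<^sub>1 F \<and> le q\<^sub>2 G))" for q q\<^sub>1 q\<^sub>2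
  have "\<exists>q\<^sub>1 q\<^sub>2. adj q q\<^sub>1 q\<^sub>2" if q: "q \<in> R" for q
  proof (rule leaning_adjunction[OF q[unfolded R_def]], goal_cases)
    case (1 q\<^sub>1 q\<^sub>2)
    then have "adj q q\<^sub>1 q\<^sub>2" by (simp add: adj_def P_def Q_def le_def)
    then show ?case by blast
  qed
  then obtain \<pi>\<^sub>1 \<pi>\<^sub>2 where adj: "\<And>q. q \<in> R \<Longrightarrow> adj q (\<pi>\<^sub>1 q) (\<pi>\<^sub>2 q)" by metis
  then have \<pi>: "\<And>q. q \<in> R \<Longrightarrow> \<pi>\<^sub>1 q \<in> P" "\<And>q. q \<in> R \<Longrightarrow> \<pi>\<^sub>2 q \<in> Q"
    and left: "\<And>q F G. q \<in> R \<Longrightarrow> F \<in> P \<Longrightarrow> G \<in> Q \<Longrightarrow>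
      le (over_forest F G) q \<longleftrightarrow> le F (\<pi>\<^sub>1 q) \<and> le G (\<pi>\<^sub>2 q)"
    and right: "\<And>q F G. q \<in> R \<Longrightarrow> F \<in> P \<Longrightarrow> G \<in> Q \<Longrightarrow>
      le q (under_forest F G) \<longleftrightarrow> le (\<pi>\<^sub>1 q) F \<and> le (\<pi>\<^sub>2 q) G"
    unfolding adj_def by blast+
  have "Poly_Mapping.lookup (mult (H_basis S ar F\<^sub>1 :: ('s, 'k) vec) (H_basis S ar F\<^sub>2)) Y =
      (\<Sum>F\<in>P. \<Sum>G\<in>Q. of_bool (over_forest F G = Y) * (h F * k G))"
    unfolding h_def k_def
    using lookup_mult[OF fin(1) keys_H_basis[OF F1, folded P_def] fin(2) keys_H_basis[OF F2, folded Q_def]] .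
  \<comment> \<open>The left adjunction separates the condition on the over product into one on
    \<open>F\<close> and one on \<open>G\<close>.\<close>
  also have "\<dots> = (\<Sum>F\<in>P. \<Sum>G\<in>Q. \<Sum>q\<in>R. \<mu> q Y * (h F * of_bool (le F (\<pi>\<^sub>1 q)) * (k G * of_bool (le G (\<pi>\<^sub>2 q)))))"
  proof (intro sum.cong refl)
    fix F G assume FG: "F \<in> P" "G \<in> Q"
    have "of_bool (over_forest F G = Y) * (h F * k G) =
        (\<Sum>q\<in>R. of_bool (le (over_forest F G) q) * \<mu> q Y * (h F * k G))"
      unfolding expand[OF over[OF FG]] sum_distrib_right ..
    also have "\<dots> = (\<Sum>q\<in>R. \<mu> q Y * (h F * of_bool (le F (\<pi>\<^sub>1 q)) * (k G * of_bool (le G (\<pi>\<^sub>2 q)))))"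
      by (intro sum.cong refl) (simp add: left[OF _ FG])
    finally show "of_bool (over_forest F G = Y) * (h F * k G) =
        (\<Sum>q\<in>R. \<mu> q Y * (h F * of_bool (le F (\<pi>\<^sub>1 q)) * (k G * of_bool (le G (\<pi>\<^sub>2 q)))))" .
  qed
  also have "\<dots> = (\<Sum>F\<in>P. \<Sum>q\<in>R. \<Sum>G\<in>Q. \<mu> q Y * (h F * of_bool (le F (\<pi>\<^sub>1 q)) * (k G * of_bool (le G (\<pi>\<^sub>2 q)))))"
    by (intro sum.cong refl sum.swap)
  also have "\<dots> = (\<Sum>q\<in>R. \<Sum>F\<in>P. \<Sum>G\<in>Q. \<mu> q Y * (h F * of_bool (le F (\<pi>\<^sub>1 q)) * (k G * of_bool (le G (\<pi>\<^sub>2 q)))))"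
    by (rule sum.swap)
  \<comment> \<open>For each \<open>q\<close> the two inner sums are the coordinates of the two
    factors at the components of the cut of \<open>q\<close>.\<close>
  also have "\<dots> = (\<Sum>q\<in>R. \<mu> q Y * ((\<Sum>F\<in>P. h F * of_bool (le F (\<pi>\<^sub>1 q))) * (\<Sum>G\<in>Q. k G * of_bool (le G (\<pi>\<^sub>2 q)))))"
    by (subst sum_product) (simp only: sum_distrib_left)
  also have "\<dots> = (\<Sum>q\<in>R. of_bool (le q (under_forest F\<^sub>1 F\<^sub>2)) * \<mu> q Y)"
  proof (intro sum.cong refl)
    fix q assume q: "q \<in> R"
    have "(\<Sum>F\<in>P. h F * of_bool (le F (\<pi>\<^sub>1 q))) = of_bool (le (\<pi>\<^sub>1 q) F\<^sub>1)"
      using sum_lookup_H_basis[OF F1] \<pi>(1)[OF q] unfolding P_def h_def le_def by blast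
    moreover have "(\<Sum>G\<in>Q. k G * of_bool (le G (\<pi>\<^sub>2 q))) = of_bool (le (\<pi>\<^sub>2 q) F\<^sub>2)"
      using sum_lookup_H_basis[OF F2] \<pi>(2)[OF q] unfolding Q_def k_def le_def by blast
    ultimately show "\<mu> q Y * ((\<Sum>F\<in>P. h F * of_bool (le F (\<pi>\<^sub>1 q))) * (\<Sum>G\<in>Q. k G * of_bool (le G (\<pi>\<^sub>2 q)))) =
        of_bool (le q (under_forest F\<^sub>1 F\<^sub>2)) * \<mu> q Y"
      \<comment> \<open>The right adjunction reassembles the two indicators into the condition that
        \<open>q\<close> lies below the under product.\<close>
      using right[OF q] F1 F2 by (simp add: P_def Q_def of_bool_conj)
  qed
  also have "\<dots> = Poly_Mapping.lookup (H_basis S ar (under_forest F\<^sub>1 F\<^sub>2) :: ('s, 'k) vec) Y"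
    unfolding R_def le_def \<mu>_def
    by (rule lookup_H_basis[OF over_under_leanings(2)[OF F1 F2], symmetric])
  finally show "Poly_Mapping.lookup (mult (H_basis S ar F\<^sub>1 :: ('s, 'k) vec) (H_basis S ar F\<^sub>2)) Y =
      Poly_Mapping.lookup (H_basis S ar (under_forest F\<^sub>1 F\<^sub>2)) Y" .
qed

end
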